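(* Let $D=(V,A)$ be a directed acyclic graph with source $s\in V$ and sink $t\in V$ such that for every node $v\in V\setminus\{s,t\}$ there exists an $s$-$t$-path in $D$ which does not traverse $v$. Then the simple extension complexity of the uncapacitated $s$-$t$-flow polytope $P_{s\text{-}t\text{-flow}}(D)\subseteq\mathbb{R}_+^A$ is equal to the number of distinct $s$-$t$-paths in $D$.
   Context: $P_{s\text{-}t\text{-flow}}(D)$ is the polytope of all uncapacitated nonnegative $s$-$t$-flows $y\in\mathbb{R}_+^A$ of flow value $1$; since $D$ is acyclic, it equals the convex hull of the characteristic vectors in $\{0,1\}^A$ of the arc sets of all directed $s$-$t$-paths in $D$. An extension of a polytope $P$ is a polytope $Q$ together with a linear map $\pi$ (a projection) with $\pi(Q)=P$. The size of a polytope is its number of facets. Faces of a polytope include the empty face (of dimension $-1$) and the polytope itself; a facet is a face of dimension one less than the polytope (so a single point has exactly one facet, the empty face). A $d$-dimensional polytope is simple if every vertex is contained in exactly $d$ facets. The simple extension complexity $\operatorname{sxc}(P)$ is the smallest size of any simple polytope $Q$ that is an extension of $P$. *)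

theory Defs
  imports "HOL-Analysis.Analysis" "HOL-Analysis.Finite_Function_Topology" "Graph_Theory.Arc_Walk"
begin

section \<open>Flow polytopes\<close>

text \<open>
  Vectors of \<open>\<real>\<^sup>A\<close>, where \<open>A\<close> is the arc set of \<open>D\<close>, are represented as vectors indexed by the
  finite type of possible arcs that vanish outside of \<open>arcs D\<close>.
\<close>

definition st_flow_polytope :: "('v, 'e::finite) pre_digraph \<Rightarrow> 'v \<Rightarrow> 'v \<Rightarrow> (real ^ 'e) set" where
  "st_flow_polytope D s t = {y.
     (\<forall>e. e \<notin> arcs D \<longrightarrow> y $ e = 0) \<and>
     (\<forall>e\<in>arcs D. 0 \<le> y $ e) \<and>
     (\<forall>v\<in>verts D - {s, t}. (\<Sum>e\<in>in_arcs D v. y $ e) = (\<Sum>e\<in>out_arcs D v. y $ e)) \<and>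
     (\<Sum>e\<in>out_arcs D s. y $ e) - (\<Sum>e\<in>in_arcs D s. y $ e) = 1}"

section \<open>Simple polytopes and simple extension complexity\<close>

text \<open>
  The formula is that of \<^const>\<open>aff_dim\<close>, without its restriction to Euclidean spaces. It is only
  applied to polytopes and their faces, whose affine hulls are finite-dimensional.
\<close>

definition affine_dim :: "'a::real_vector set \<Rightarrow> int" where
  "affine_dim S = (SOME d :: int.
     \<exists>B. affine hull B = affine hull S \<and> \<not> affine_dependent B \<and> of_nat (card B) = d + 1)"

lemma affine_dim_eq_aff_dim: "affine_dim (S :: 'a::euclidean_space set) = aff_dim S"
  by (simp add: affine_dim_def aff_dim_def)

text \<open>
  In contrast to \<^const>\<open>facet_of\<close>, the empty face (of dimension \<open>-1\<close>) is admitted as a facet, so a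
  single point has exactly one facet.
\<close>

definition facets :: "'a::real_vector set \<Rightarrow> 'a set set" where
  "facets P = {F. F face_of P \<and> affine_dim F = affine_dim P - 1}"

definition simple_polytope :: "'a::real_vector set \<Rightarrow> bool" where
  "simple_polytope P \<longleftrightarrow> polytope P \<and>
     (\<forall>v. v extreme_point_of P \<longrightarrow> int (card {F \<in> facets P. v \<in> F}) = affine_dim P)"

definition extension_of :: "'b::real_vector set \<Rightarrow> 'a::real_vector set \<Rightarrow> bool" where
  "extension_of Q P \<longleftrightarrow> polytope Q \<and> (\<exists>\<pi>. linear \<pi> \<and> \<pi> ` Q = P)"

text \<open>
  The polytope \<open>Q\<close> may live in any \<open>\<real>\<^sup>m\<close>. To quantify over all \<open>m\<close>, \<open>\<real>\<^sup>m\<close> is identified with the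
  subspace of those finitely supported sequences of reals that vanish from index \<open>m\<close> on. A polytope of
  finitely supported sequences, being the convex hull of a finite set, lies in one of these
  subspaces, and a linear map on \<open>\<real>\<^sup>m\<close> extends to all finitely supported sequences.
\<close>

definition sxc :: "'a::real_vector set \<Rightarrow> nat" where
  "sxc P = (LEAST k. \<exists>Q :: (nat \<Rightarrow>\<^sub>0 real) set.
     simple_polytope Q \<and> extension_of Q P \<and> k = card (facets Q))"

end

theory Submission
  imports Defs
begin

text \<open>
  The number \<open>N\<close> of paths is an upper bound because the flow polytope \<open>P\<close> is the convex hull of the
  \<open>N\<close> path vectors: it is a projection of the simplex with \<open>N\<close> vertices, which is simple and has \<open>N\<close>
  facets (\<open>convex_hull_finite_simplex_extension\<close>). For \<open>N = 1\<close> this is a point with its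
  empty facet, for \<open>N = 0\<close> the empty polytope.

  For the lower bound, let \<open>\<pi>\<close> project a simple polytope \<open>Q\<close> onto \<open>P\<close>. The flows supported on a set
  \<open>S\<close> of arcs form a face of \<open>P\<close>, so their preimage \<open>Q\<^sub>S\<close> is a face of \<open>Q\<close>. Fix a facet \<open>F\<close> of \<open>Q\<close> and
  let \<open>J\<close> be the family of all \<open>S\<close> with \<open>Q\<^sub>S \<subseteq> F\<close>. It is closed under subsets, and because \<open>Q\<close> is
  simple it is prime: if \<open>S \<inter> T\<close> belongs to \<open>J\<close> and contains a path, then \<open>S\<close> or \<open>T\<close> belongs to \<open>J\<close>.
  Indeed, from every vertex of \<open>Q\<close> on \<open>F\<close> an edge leaves \<open>F\<close> that lies in all faces through that vertex
  that are not contained in \<open>F\<close>; two such faces therefore cannot meet inside \<open>F\<close> only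
  (\<open>simple_polytope_facet_prime\<close>).

  The combinatorial core is \<open>prime_ideal_misses_one_path\<close>: if such a family \<open>J\<close> contains one path and
  misses another, then it misses only that one. This is where the paths that avoid a given vertex
  enter. Now the faces \<open>Q\<^sub>p\<close> for different paths \<open>p\<close> are nonempty and disjoint, and a nonempty face can
  be separated from a point outside of it by a facet (\<open>facet_separating\<close>). So for every path \<open>p\<close>
  there is a facet whose family misses \<open>p\<close>, hence only \<open>p\<close>, and different paths get
  different facets. If there is only one path, it suffices that \<open>Q\<close> has a facet at all.

  The polytope \<open>Q\<close> consists of finitely supported sequences, so what is needed about faces is proved
  in arbitrary real vector spaces. There are no supporting hyperplanes in these proofs:
  larger faces are obtained from a minimal generating system of the cone that the polytope spans at a
  given face (\<open>larger_face_avoiding\<close>).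
\<close>

section \<open>Affine dimension\<close>

text \<open>
  Translating a point of \<open>C\<close> and a point of \<open>D\<close> to the origin reduces this to the exchange lemma for
  linearly independent sets.
\<close>

lemma affine_independent_card_le:
  fixes C D :: "'a::real_vector set"
  assumes "finite D" "\<not> affine_dependent C" "C \<subseteq> affine hull D"
  shows "finite C \<and> card C \<le> card D"
proof (cases "C = {}")
  case False
  then obtain c where c: "c \<in> C" by blast
  with assms(3) have "D \<noteq> {}" by auto
  then obtain d where d: "d \<in> D" by blast
  let ?D = "(\<lambda>x. -d + x) ` (D - {d})" and ?C = "(\<lambda>x. -c + x) ` (C - {c})"
  have hull: "affine hull D = (\<lambda>x. d + x) ` span ?D"
    using d by (rule affine_hull_span2)
  have "?C \<subseteq> span ?D"
  proof
    fix z assume "z \<in> ?C"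
    then obtain x where x: "x \<in> C" "z = - c + x" by blast
    obtain x' c' where "x' \<in> span ?D" "x = d + x'" "c' \<in> span ?D" "c = d + c'"
      using assms(3) x(1) c hull by blast
    then have "z = x' - c'" "x' - c' \<in> span ?D" using span_diff x(2) by auto
    then show "z \<in> span ?D" by simp
  qed
  moreover have "independent ?C"
    using assms(2) affine_dependent_iff_dependent2[OF c] by blast
  ultimately have "finite ?C \<and> card ?C \<le> card ?D"
    using assms(1) by (intro independent_span_bound) auto
  moreover have "card ?C = card (C - {c})" "card ?D = card (D - {d})"
    by (auto intro!: card_image inj_onI)
  moreover have "finite (C - {c})"
    using calculation(1) by (auto dest!: finite_imageD intro: inj_onI)
  ultimately show ?thesis
    using c d assms(1) by (auto simp: card_Diff_singleton_if) (metis One_nat_def Suc_pred card_gt_0_iff empty_iff not_less_eq_eq)+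
qed simp

text \<open>
  All affine bases of \<open>affine hull S\<close> have the same number of elements, so any one of them determines the value of
  the choice operator in the definition of \<^const>\<open>affine_dim\<close>.
\<close>

lemma affine_dim_eq_card:
  assumes "finite B" "\<not> affine_dependent B" "affine hull B = affine hull S"
  shows "affine_dim S = int (card B) - 1"
  unfolding affine_dim_def
proof (rule some_equality)
  show "\<exists>C. affine hull C = affine hull S \<and> \<not> affine_dependent C \<and> int (card C) = int (card B) - 1 + 1"
    using assms by auto
  fix d assume "\<exists>C. affine hull C = affine hull S \<and> \<not> affine_dependent C \<and> int (card C) = d + 1"
  then obtain C where C: "affine hull C = affine hull S" "\<not> affine_dependent C" "int (card C) = d + 1"
    by blast
  have "C \<subseteq> affine hull B" "B \<subseteq> affine hull C" using assms(3) C(1) by (metis hull_subset)+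
  then have "card C = card B"
    using affine_independent_card_le assms C by (metis le_antisym)
  with C(3) show "d = int (card B) - 1" by simp
qed

lemma polytope_affine_basis:
  assumes "polytope G"
  obtains B where "finite B" "B \<subseteq> G" "\<not> affine_dependent B" "affine hull B = affine hull G"
    "affine_dim G = int (card B) - 1"
proof -
  obtain V where V: "finite V" "G = convex hull V" using assms unfolding polytope_def by blast
  obtain B where "B \<subseteq> V" "\<not> affine_dependent B" "affine hull V = affine hull B"
    using affine_basis_exists by blast
  moreover have "B \<subseteq> G" "finite B" using V \<open>B \<subseteq> V\<close> by (auto simp: hull_inc finite_subset)
  ultimately show ?thesis
    using V that affine_dim_eq_card[of B G] by simp
qed

lemma affine_dim_mono:
  assumes "polytope F" "polytope G" "F \<subseteq> affine hull G"
  shows "affine_dim F \<le> affine_dim G"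
proof -
  obtain B where B: "B \<subseteq> F" "\<not> affine_dependent B" "affine_dim F = int (card B) - 1"
    using polytope_affine_basis[OF assms(1)] by metis
  obtain C where C: "finite C" "affine hull C = affine hull G" "affine_dim G = int (card C) - 1"
    using polytope_affine_basis[OF assms(2)] by metis
  have "card B \<le> card C"
    using affine_independent_card_le[OF C(1) B(2)] B(1) C(2) assms(3) by auto
  with B C show ?thesis by simp
qed

lemma affine_dim_eq_imp_affine_hull_eq:
  assumes "polytope F" "polytope G" "F \<subseteq> G" "F \<noteq> {}" "affine_dim F = affine_dim G"
  shows "affine hull F = affine hull G"
proof -
  obtain B where B: "finite B" "B \<subseteq> F" "\<not> affine_dependent B" "affine hull B = affine hull F"
    "affine_dim F = int (card B) - 1"
    using polytope_affine_basis[OF assms(1)] by metis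
  obtain C where C: "finite C" "affine hull C = affine hull G" "affine_dim G = int (card C) - 1"
    using polytope_affine_basis[OF assms(2)] by metis
  have "B \<noteq> {}" using B(4) assms(4) by auto
  then obtain T where T: "\<not> affine_dependent T" "B \<subseteq> T" "T \<subseteq> G" "affine hull T = affine hull G"
    using extend_to_affine_basis_nonempty[OF B(3), of G] B(2) assms(3) by (metis subset_trans)
  have "T \<subseteq> affine hull C" using T(3) C(2) hull_subset by (metis subset_trans)
  then have "finite T" "card T \<le> card B"
    using affine_independent_card_le[OF C(1) T(1)] B(5) C(3) assms(5) by auto
  then have "B = T" using T(2) by (metis card_seteq)
  with B(4) T(4) show ?thesis by simp
qed

lemma affine_dim_le_insert:
  assumes "polytope F" "polytope G" "G \<subseteq> affine hull (insert w F)"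
  shows "affine_dim G \<le> affine_dim F + 1"
proof -
  obtain B where B: "finite B" "affine hull B = affine hull F" "affine_dim F = int (card B) - 1"
    using polytope_affine_basis[OF assms(1)] by metis
  obtain C where C: "C \<subseteq> G" "\<not> affine_dependent C" "affine_dim G = int (card C) - 1"
    using polytope_affine_basis[OF assms(2)] by metis
  have "affine hull (insert w F) = affine hull (insert w B)"
    by (metis B(2) hull_insert)
  then have "card C \<le> card (insert w B)"
    using affine_independent_card_le[of "insert w B" C] B(1) C assms(3) by auto
  also have "\<dots> \<le> card B + 1" by (simp add: card_insert_le_m1 B(1) card_insert_if)
  finally show ?thesis using B C by simp
qed

lemma affine_dim_singleton: "affine_dim {x} = 0"
  using affine_dim_eq_card[of "{x}" "{x}"] by simp

lemma affine_dim_empty: "affine_dim {} = -1"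
  using affine_dim_eq_card[of "{}" "{}"] by simp

section \<open>Faces of polytopes\<close>

text \<open>
  If \<open>v\<close> is not the only point with a positive coefficient, the combination lies strictly between \<open>v\<close>
  and the normalised combination of the other points.
\<close>

lemma face_of_convex_sum_support:
  assumes F: "F face_of S" and S: "convex S" and V: "finite V" "V \<subseteq> S"
    and u: "\<And>v. v \<in> V \<Longrightarrow> 0 \<le> u v" "sum u V = (1::real)"
    and x: "(\<Sum>v\<in>V. u v *\<^sub>R v) \<in> F" and v: "v \<in> V" "u v > 0"
  shows "v \<in> F"
proof -
  define x where "x = (\<Sum>v\<in>V. u v *\<^sub>R v)"
  have xs: "x = u v *\<^sub>R v + (\<Sum>w\<in>V-{v}. u w *\<^sub>R w)"
    unfolding x_def using V v by (simp add: sum.remove)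
  have us: "sum u (V - {v}) = 1 - u v" using V v u by (simp add: sum_diff1)
  show ?thesis
  proof (cases "u v = 1")
    case True
    then have "\<forall>w\<in>V-{v}. u w = 0"
      using us u V sum_nonneg_eq_0_iff[of "V - {v}" u] by auto
    then have "x = v" using xs True by simp
    then show ?thesis using x x_def by simp
  next
    case False
    have "sum u (V - {v}) \<ge> 0" using u by (intro sum_nonneg) auto
    with False us have lt: "u v < 1" by linarith
    define w where "w = (\<Sum>w\<in>V-{v}. (u w / (1 - u v)) *\<^sub>R w)"
    have "w \<in> S" unfolding w_def
      using V u lt us by (intro convex_sum[OF _ S]) (auto simp flip: sum_divide_distrib)
    have "(1 - u v) *\<^sub>R w = (\<Sum>w\<in>V-{v}. u w *\<^sub>R w)"
      unfolding w_def scaleR_sum_right using lt by simp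
    then have xw: "x = (1 - u v) *\<^sub>R w + u v *\<^sub>R v" using xs by simp
    show ?thesis
    proof (cases "v = w")
      case True
      then have "x = v" using xw by (simp flip: scaleR_add_left)
      then show ?thesis using x x_def by simp
    next
      case False
      then have "x \<in> open_segment w v" using xw lt v(2) by (auto simp: in_segment)
      then show ?thesis using face_ofD[OF F _ \<open>w \<in> S\<close>, of x v] v V x x_def by auto
    qed
  qed
qed

lemma face_of_convex_hull_Int:
  assumes V: "finite V" and F: "F face_of (convex hull V)"
  shows "F = convex hull (F \<inter> V)"
proof (rule antisym)
  show "convex hull (F \<inter> V) \<subseteq> F"
    using face_of_imp_convex[OF F] by (simp add: subset_hull)
  show "F \<subseteq> convex hull (F \<inter> V)"
  proof
    fix x assume x: "x \<in> F"
    then have "x \<in> convex hull V" using face_of_imp_subset[OF F] by blast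
    then obtain u where u: "\<And>v. v \<in> V \<Longrightarrow> 0 \<le> u v" "sum u V = 1" "(\<Sum>v\<in>V. u v *\<^sub>R v) = x"
      unfolding convex_hull_finite[OF V] by auto
    have "v \<in> F" if "v \<in> V" "u v \<noteq> 0" for v
      using face_of_convex_sum_support[OF F convex_convex_hull V hull_subset u(1,2)] u(1)[of v] u(3) x that
      by auto
    then have z: "\<forall>v\<in>V - F \<inter> V. u v = 0" by auto
    have "sum u V = sum u (F \<inter> V)"
      using V z by (intro sum.mono_neutral_right) auto
    moreover have "(\<Sum>v\<in>V. u v *\<^sub>R v) = (\<Sum>v\<in>F \<inter> V. u v *\<^sub>R v)"
      using V z by (intro sum.mono_neutral_right) auto
    ultimately have "sum u (F \<inter> V) = 1" "(\<Sum>v\<in>F \<inter> V. u v *\<^sub>R v) = x"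
      using u(2,3) by auto
    then show "x \<in> convex hull (F \<inter> V)"
      using u(1) V by (subst convex_hull_finite) auto
  qed
qed

text \<open>
  In an affine combination \<open>x\<close> of points of \<open>F\<close>, collect the positive and the negative coefficients:
  this gives points \<open>p\<close> and \<open>n\<close> of \<open>F\<close> such that \<open>p\<close> lies between \<open>x\<close> and \<open>n\<close>, and then \<open>x \<in> F\<close>
  because \<open>F\<close> is a face.
\<close>

lemma face_of_eq_affine_Int:
  assumes S: "convex S" and F: "F face_of S"
  shows "affine hull F \<inter> S = F"
proof (rule antisym)
  show "F \<subseteq> affine hull F \<inter> S" using face_of_imp_subset[OF F] hull_subset[of F affine] by blast
  show "affine hull F \<inter> S \<subseteq> F"
  proof
    fix x assume "x \<in> affine hull F \<inter> S"
    then obtain T u where T: "finite T" "T \<subseteq> F" "sum u T = 1" "(\<Sum>v\<in>T. u v *\<^sub>R v) = x"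
      and xS: "x \<in> S" unfolding affine_hull_explicit by blast
    have cF: "convex F" using F by (rule face_of_imp_convex)
    define P N where "P = {v\<in>T. u v > 0}" and "N = {v\<in>T. \<not> u v > 0}"
    define a b where "a = sum u P" and "b = sum (\<lambda>v. - u v) N"
    have PN: "finite P" "finite N" "T = P \<union> N" "P \<inter> N = {}" "P \<subseteq> F" "N \<subseteq> F"
      using T unfolding P_def N_def by auto
    have ab: "a - b = 1" using T(3) unfolding a_def b_def PN(3) sum.union_disjoint[OF PN(1,2,4)] by (simp add: sum_negf)
    have b0: "b \<ge> 0" unfolding b_def by (intro sum_nonneg) (auto simp: N_def)
    have x: "x = (\<Sum>v\<in>P. u v *\<^sub>R v) - (\<Sum>v\<in>N. (- u v) *\<^sub>R v)"
      using T(4) unfolding PN(3) sum.union_disjoint[OF PN(1,2,4)] by (simp add: sum_negf)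
    define p n where "p = (\<Sum>v\<in>P. (u v / a) *\<^sub>R v)" and "n = (\<Sum>v\<in>N. (- u v / b) *\<^sub>R v)"
    have p: "p \<in> F" unfolding p_def
    proof (rule convex_sum[OF PN(1) cF])
      show "(\<Sum>v\<in>P. u v / a) = 1" using ab b0 by (simp add: a_def[symmetric] flip: sum_divide_distrib)
    qed (use PN(5) ab b0 in \<open>auto simp: P_def\<close>)
    have ap: "a *\<^sub>R p = (\<Sum>v\<in>P. u v *\<^sub>R v)"
      unfolding p_def scaleR_sum_right using ab b0 by simp
    show "x \<in> F"
    proof (cases "b = 0")
      case True
      then have "\<forall>v\<in>N. - u v = 0" unfolding b_def using PN(2)
        by (subst (asm) sum_nonneg_eq_0_iff) (auto simp: N_def)
      then have "x = p" using x ap ab True by simp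
      then show ?thesis using p by simp
    next
      case False
      have n: "n \<in> F" unfolding n_def
      proof (rule convex_sum[OF PN(2) cF])
        show "(\<Sum>v\<in>N. - u v / b) = 1"
          using False by (simp only: b_def[symmetric] sum_divide_distrib[symmetric]) simp
      qed (use PN(6) b0 in \<open>auto simp: N_def divide_nonpos_nonneg\<close>)
      have bn: "b *\<^sub>R n = (\<Sum>v\<in>N. (- u v) *\<^sub>R v)"
        unfolding n_def scaleR_sum_right using False by simp
      have "x + b *\<^sub>R n = a *\<^sub>R p" using x ap bn by simp
      then have "p = (1 / a) *\<^sub>R (x + b *\<^sub>R n)" using ab b0 by simp
      also have "\<dots> = (1 - b / a) *\<^sub>R x + (b / a) *\<^sub>R n"
        using ab b0 by (simp add: field_simps scaleR_add_right)
      finally have pe: "p = (1 - b / a) *\<^sub>R x + (b / a) *\<^sub>R n" .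
      show ?thesis
      proof (cases "x = n")
        case False
        then have "p \<in> open_segment x n"
          unfolding in_segment using pe ab b0 \<open>b \<noteq> 0\<close> by (intro conjI exI[of _ "b / a"]) auto
        then show ?thesis using face_ofD[OF F _ xS, of p n] p n face_of_imp_subset[OF F] by blast
      qed (use n in simp)
    qed
  qed
qed

lemma polytope_face_of:
  assumes "polytope G" "F face_of G"
  shows "polytope F"
proof -
  obtain V where V: "finite V" "G = convex hull V" using assms(1) unfolding polytope_def by blast
  have "F = convex hull (F \<inter> V)" using face_of_convex_hull_Int[OF V(1)] assms(2) V(2) by simp
  then show ?thesis using V(1) unfolding polytope_def by (meson finite_Int)
qed

lemma finite_faces_of_polytope:
  assumes "polytope G"
  shows "finite {F. F face_of G}"
proof -
  obtain V where V: "finite V" "G = convex hull V" using assms unfolding polytope_def by blast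
  have "{F. F face_of G} \<subseteq> (\<lambda>W. convex hull W) ` Pow V"
    using face_of_convex_hull_Int[OF V(1)] V(2) by blast
  then show ?thesis using V(1) finite_subset by blast
qed

lemma face_of_affine_dim_less:
  assumes "polytope G" "F face_of G" "F \<noteq> G"
  shows "affine_dim F < affine_dim G"
proof -
  have F: "polytope F" "F \<subseteq> G" using assms polytope_face_of face_of_imp_subset by blast+
  have le: "affine_dim F \<le> affine_dim G"
    using affine_dim_mono[OF F(1) assms(1)] F(2) hull_subset by (metis subset_trans)
  have "affine_dim F \<noteq> affine_dim G"
  proof
    assume eq: "affine_dim F = affine_dim G"
    show False
    proof (cases "F = {}")
      case True
      obtain B where "finite B" "affine hull B = affine hull G" "affine_dim G = int (card B) - 1"
        using polytope_affine_basis[OF assms(1)] by metis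
      then have "B = {}" using eq True by (simp add: affine_dim_empty)
      then have "G = {}" using \<open>affine hull B = affine hull G\<close> by simp
      then show False using True assms(3) by simp
    next
      case False
      then have "affine hull F = affine hull G"
        using affine_dim_eq_imp_affine_hull_eq F assms(1) eq by blast
      then show False
        using face_of_eq_affine_Int[OF polytope_imp_convex[OF assms(1)] assms(2)] assms(3) hull_subset[of G affine] by auto
    qed
  qed
  with le show ?thesis by simp
qed

text \<open>
  Add the generators one at a time: a new generator is either redundant or itself an extreme point.
\<close>

lemma extreme_point_exists_polytope:
  assumes "polytope G" "G \<noteq> {}"
  obtains x where "x extreme_point_of G"
proof -
  have "\<exists>x. x extreme_point_of (convex hull V)" if "finite V" "V \<noteq> {}" for V :: "'a set"
    using that
  proof (induction rule: finite_ne_induct)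
    case (insert v V)
    show ?case
    proof (cases "v \<in> convex hull V")
      case True
      then show ?thesis using insert by (simp add: hull_redundant)
    next
      case False
      then show ?thesis using insert extreme_point_of_convex_hull_insert by blast
    qed
  qed auto
  then show ?thesis using assms that unfolding polytope_def by (metis convex_hull_empty)
qed

section \<open>Facets separating a face from a point\<close>

text \<open>
  Modulo the directions \<open>L\<close> of \<open>F\<close>, the polytope \<open>G\<close> spans at \<open>F\<close> a pointed cone, generated by the
  vectors \<open>v - f0\<close> for the generators \<open>v\<close> of \<open>G\<close> outside of \<open>F\<close>. A minimal generating subset \<open>W\<close> consists
  of representatives of its extreme rays, and the part \<open>R w\<close> of \<open>G\<close> over the ray of \<open>w\<close> is a face of
  \<open>G\<close>. The assumption on affine hulls says that the cone is more than a ray, so it has two extreme rays,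
  and \<open>y\<close> lies over at most one of them.
\<close>

lemma larger_face_avoiding:
  assumes G: "polytope G" and F: "F face_of G" "F \<noteq> {}" and y: "y \<in> G" "y \<notin> F"
    and dim: "\<And>w. \<not> G \<subseteq> affine hull (insert w F)"
  obtains F' where "F' face_of G" "F \<subset> F'" "y \<notin> F'"
proof -
  obtain V where V: "finite V" "G = convex hull V" using G unfolding polytope_def by blast
  have cG: "convex G" using G by (rule polytope_imp_convex)
  have FG: "F \<subseteq> G" using F(1) by (rule face_of_imp_subset)
  have VG: "V \<subseteq> G" using V(2) hull_subset[of V convex] by simp
  obtain f0 where f0: "f0 \<in> F" using F(2) by blast
  define L where "L = span ((\<lambda>x. -f0 + x) ` F)"
  have L: "subspace L" unfolding L_def by simp
  have LF: "x - f0 \<in> L" if "x \<in> F" for x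
    unfolding L_def using that by (intro span_base) auto
  have inF: "x \<in> F" if "x \<in> G" "x - f0 \<in> L" for x
  proof -
    have "x = f0 + (x - f0)" by simp
    then have "x \<in> affine hull F"
      using affine_hull_span_gen[of f0 F] f0 hull_inc[of f0 F affine] that(2) unfolding L_def by blast
    then show ?thesis using face_of_eq_affine_Int[OF cG F(1)] that(1) by blast
  qed
  \<comment> \<open>A nontrivial combination with value in \<open>L\<close> would, after normalisation, be a point of \<open>F\<close> that
    is a convex combination of generators outside of \<open>F\<close>.\<close>
  have pointed: "\<delta> u = 0"
    if X: "X \<subseteq> V - F" and nn: "\<And>u. u \<in> X \<Longrightarrow> 0 \<le> \<delta> u" and mem: "(\<Sum>u\<in>X. \<delta> u *\<^sub>R (u - f0)) \<in> L"
      and u: "u \<in> X" for X and \<delta> :: "'a \<Rightarrow> real" and u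
  proof (rule ccontr)
    assume "\<delta> u \<noteq> 0"
    have fX: "finite X" using X V(1) finite_subset by blast
    define \<Delta> where "\<Delta> = sum \<delta> X"
    have pos: "\<Delta> > 0" unfolding \<Delta>_def using fX u nn \<open>\<delta> u \<noteq> 0\<close>
      by (intro sum_pos2[of X u]) (auto simp: order_less_le)
    define m where "m = (\<Sum>v\<in>X. (\<delta> v / \<Delta>) *\<^sub>R v)"
    have s1: "(\<Sum>v\<in>X. \<delta> v / \<Delta>) = 1" using pos by (simp add: \<Delta>_def flip: sum_divide_distrib)
    have nn': "0 \<le> \<delta> v / \<Delta>" if "v \<in> X" for v using nn[OF that] pos by simp
    have XG: "X \<subseteq> G" using X VG by blast
    have mG: "m \<in> G" unfolding m_def by (rule convex_sum[OF fX cG s1 nn']) (use XG in auto)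
    have "m - f0 = (1 / \<Delta>) *\<^sub>R (\<Sum>u\<in>X. \<delta> u *\<^sub>R (u - f0))"
      using pos by (simp add: m_def \<Delta>_def[symmetric] scaleR_sum_right scaleR_diff_right sum_subtractf
          flip: scaleR_sum_left sum_divide_distrib)
    then have "m - f0 \<in> L" using mem L by (simp add: subspace_scale)
    then have "m \<in> F" using inF mG by blast
    then have "u \<in> F"
      unfolding m_def
      using face_of_convex_sum_support[OF F(1) cG fX XG nn' s1 _ u] pos nn[OF u] \<open>\<delta> u \<noteq> 0\<close> by auto
    then show False using X u by blast
  qed
  \<comment> \<open>nonnegative coordinates \<open>c\<close> of \<open>z - f0\<close>, modulo \<open>L\<close>, with respect to the generators \<open>W\<close>\<close>
  define rep where "rep W z c \<longleftrightarrow> (\<forall>w\<in>W. 0 \<le> c w) \<and> z - f0 - (\<Sum>w\<in>W. c w *\<^sub>R (w - f0)) \<in> L"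
    for W z and c :: "'a \<Rightarrow> real"
  define gen where "gen W \<longleftrightarrow> W \<subseteq> V - F \<and> (\<forall>z\<in>G. \<exists>c. rep W z c)" for W
  have "gen (V - F)"
    unfolding gen_def
  proof (intro conjI ballI)
    fix z assume "z \<in> G"
    then obtain u where u: "\<And>v. v \<in> V \<Longrightarrow> 0 \<le> u v" "sum u V = 1" "(\<Sum>v\<in>V. u v *\<^sub>R v) = z"
      unfolding V(2) convex_hull_finite[OF V(1)] by auto
    have "z - f0 = (\<Sum>v\<in>V. u v *\<^sub>R (v - f0))"
      using u(2,3) by (simp add: scaleR_diff_right sum_subtractf flip: scaleR_sum_left)
    also have "\<dots> = (\<Sum>v\<in>V - F. u v *\<^sub>R (v - f0)) + (\<Sum>v\<in>V \<inter> F. u v *\<^sub>R (v - f0))"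
      using V(1) by (subst sum.union_disjoint[symmetric]) (auto intro: sum.cong)
    finally have "z - f0 - (\<Sum>v\<in>V - F. u v *\<^sub>R (v - f0)) = (\<Sum>v\<in>V \<inter> F. u v *\<^sub>R (v - f0))" by simp
    also have "\<dots> \<in> L" using LF L by (intro subspace_sum subspace_scale) auto
    finally show "\<exists>c. rep (V - F) z c" unfolding rep_def using u(1) by blast
  qed simp
  then obtain W where W: "gen W" and min: "\<And>W'. gen W' \<Longrightarrow> card W \<le> card W'"
    using ex_has_least_nat[of gen "V - F" card] by blast
  have WV: "W \<subseteq> V - F" and fW: "finite W" using W V(1) finite_subset unfolding gen_def by blast+
  \<comment> \<open>A generator that is itself a combination of the others could be dropped from \<open>W\<close>.\<close>
  have irredundant: False
    if w: "w \<in> W" and d: "rep (W - {w}) w d" for w d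
  proof -
    have "gen (W - {w})"
      unfolding gen_def
    proof (intro conjI ballI)
      fix z assume "z \<in> G"
      then obtain c where c: "rep W z c" using W unfolding gen_def by blast
      let ?e = "\<lambda>u. c u + c w * d u"
      have "(\<Sum>u\<in>W - {w}. ?e u *\<^sub>R (u - f0))
          = (\<Sum>u\<in>W - {w}. c u *\<^sub>R (u - f0)) + c w *\<^sub>R (\<Sum>u\<in>W - {w}. d u *\<^sub>R (u - f0))"
        by (simp add: scaleR_add_left sum.distrib scaleR_sum_right)
      then have "z - f0 - (\<Sum>u\<in>W - {w}. ?e u *\<^sub>R (u - f0))
          = (z - f0 - (\<Sum>u\<in>W. c u *\<^sub>R (u - f0))) + c w *\<^sub>R (w - f0 - (\<Sum>u\<in>W - {w}. d u *\<^sub>R (u - f0)))"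
        unfolding sum.remove[OF fW w] scaleR_diff_right[of "c w" "w - f0"] by simp
      also have "\<dots> \<in> L"
        using c d L unfolding rep_def by (intro subspace_add subspace_scale) auto
      finally have "rep (W - {w}) z ?e" using c d w unfolding rep_def by auto
      then show "\<exists>e. rep (W - {w}) z e" by blast
    qed (use WV in blast)
    from min[OF this] show False using w fW card_Diff1_less[of W w] by simp
  qed
  \<comment> \<open>Extremality: a point over the ray of \<open>w\<close> has no other coordinates. Compare two
    representations of \<open>z\<close>: if the coefficient of \<open>w\<close> drops, solving for \<open>w\<close> makes \<open>w\<close> redundant;
    otherwise the difference is a nonnegative combination in \<open>L\<close>.\<close>
  have ray_unique: "c' u = 0"
    if w: "w \<in> W" and c: "rep W z c" "\<forall>u\<in>W - {w}. c u = 0" and c': "rep W z c'" and u: "u \<in> W" "u \<noteq> w"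
    for w z c c' u
  proof -
    have eq: "(\<Sum>v\<in>W. c v *\<^sub>R (v - f0)) = c w *\<^sub>R (w - f0)"
      using fW w c(2) by (simp add: sum.remove)
    let ?s = "\<Sum>v\<in>W - {w}. c' v *\<^sub>R (v - f0)"
    have "z - f0 - c w *\<^sub>R (w - f0) \<in> L" using c(1) eq unfolding rep_def by simp
    moreover have "z - f0 - (\<Sum>v\<in>W. c' v *\<^sub>R (v - f0)) \<in> L" using c' unfolding rep_def by blast
    ultimately have "(z - f0 - c w *\<^sub>R (w - f0)) - (z - f0 - (\<Sum>v\<in>W. c' v *\<^sub>R (v - f0))) \<in> L"
      by (rule subspace_diff[OF L])
    moreover have "(z - f0 - c w *\<^sub>R (w - f0)) - (z - f0 - (\<Sum>v\<in>W. c' v *\<^sub>R (v - f0)))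
        = (c' w - c w) *\<^sub>R (w - f0) + ?s"
      unfolding sum.remove[OF fW w] scaleR_diff_left by simp
    ultimately have mem: "(c' w - c w) *\<^sub>R (w - f0) + ?s \<in> L" by simp
    show ?thesis
    proof (cases "c w > c' w")
      case True
      have "- (1 / (c w - c' w)) *\<^sub>R ((c' w - c w) *\<^sub>R (w - f0) + ?s) \<in> L"
        using mem L subspace_scale by blast
      moreover have "- (1 / (c w - c' w)) *\<^sub>R ((c' w - c w) *\<^sub>R (w - f0) + ?s)
          = w - f0 - (\<Sum>v\<in>W - {w}. (c' v / (c w - c' w)) *\<^sub>R (v - f0))"
      proof -
        have "- (1 / (c w - c' w)) * (c' w - c w) = 1" using True by (simp add: field_simps)
        then show ?thesis by (simp add: scaleR_add_right scaleR_sum_right divide_inverse mult.commute sum_negf)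
      qed
      ultimately have "rep (W - {w}) w (\<lambda>v. c' v / (c w - c' w))"
        using c' True unfolding rep_def by auto
      then show ?thesis using irredundant w by blast
    next
      case False
      let ?\<delta> = "c'(w := c' w - c w)"
      have "(\<Sum>v\<in>W. ?\<delta> v *\<^sub>R (v - f0)) = (c' w - c w) *\<^sub>R (w - f0) + ?s"
        using fW w by (simp add: sum.remove[of W w])
      then have "?\<delta> u = 0"
        using pointed[OF WV, of ?\<delta> u] mem False c' u unfolding rep_def by auto
      then show ?thesis using u(2) by simp
    qed
  qed
  have rep_comb: "rep W ((1 - t) *\<^sub>R a + t *\<^sub>R b) (\<lambda>u. (1 - t) * \<alpha> u + t * \<beta> u)"
    if "rep W a \<alpha>" "rep W b \<beta>" "0 \<le> t" "t \<le> 1" for a b \<alpha> \<beta> t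
  proof -
    have sums: "(\<Sum>w\<in>W. ((1 - t) * \<alpha> w + t * \<beta> w) *\<^sub>R (w - f0))
      = (1 - t) *\<^sub>R (\<Sum>w\<in>W. \<alpha> w *\<^sub>R (w - f0)) + t *\<^sub>R (\<Sum>w\<in>W. \<beta> w *\<^sub>R (w - f0))"
      by (simp add: scaleR_add_left sum.distrib scaleR_sum_right)
    have "((1 - t) *\<^sub>R a + t *\<^sub>R b) - f0 - (\<Sum>w\<in>W. ((1 - t) * \<alpha> w + t * \<beta> w) *\<^sub>R (w - f0))
      = (1 - t) *\<^sub>R (a - f0 - (\<Sum>w\<in>W. \<alpha> w *\<^sub>R (w - f0))) + t *\<^sub>R (b - f0 - (\<Sum>w\<in>W. \<beta> w *\<^sub>R (w - f0)))"
      unfolding sums by (simp add: algebra_simps)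
    also have "\<dots> \<in> L" using that L unfolding rep_def by (intro subspace_add subspace_scale) auto
    finally show ?thesis using that unfolding rep_def by auto
  qed
  define R where "R w = {z\<in>G. \<exists>c. rep W z c \<and> (\<forall>u\<in>W - {w}. c u = 0)}" for w
  have R_face: "R w face_of G" if w: "w \<in> W" for w
    unfolding face_of_def
  proof (intro conjI ballI impI)
    show "R w \<subseteq> G" unfolding R_def by blast
    show "convex (R w)"
      unfolding convex_alt
    proof (intro ballI allI impI)
      fix a b t assume a: "a \<in> R w" and b: "b \<in> R w" and t: "0 \<le> t \<and> t \<le> (1::real)"
      from a b obtain \<alpha> \<beta> where "rep W a \<alpha>" "\<forall>u\<in>W - {w}. \<alpha> u = 0" "rep W b \<beta>" "\<forall>u\<in>W - {w}. \<beta> u = 0"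
        unfolding R_def by blast
      then have "rep W ((1 - t) *\<^sub>R a + t *\<^sub>R b) (\<lambda>u. (1 - t) * \<alpha> u + t * \<beta> u)"
        "\<forall>u\<in>W - {w}. (1 - t) * \<alpha> u + t * \<beta> u = 0"
        using rep_comb t by auto
      moreover have "(1 - t) *\<^sub>R a + t *\<^sub>R b \<in> G"
        using a b t cG unfolding R_def convex_alt by blast
      ultimately show "(1 - t) *\<^sub>R a + t *\<^sub>R b \<in> R w" unfolding R_def by blast
    qed
    fix a b z assume ab: "a \<in> G" "b \<in> G" and z: "z \<in> R w" "z \<in> open_segment a b"
    from z(2) obtain t where t: "0 < t" "t < 1" "z = (1 - t) *\<^sub>R a + t *\<^sub>R b"
      by (auto simp: in_segment)
    obtain c where c: "rep W z c" "\<forall>u\<in>W - {w}. c u = 0" using z(1) unfolding R_def by blast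
    obtain \<alpha> \<beta> where ab': "rep W a \<alpha>" "rep W b \<beta>" using W ab unfolding gen_def by blast
    have "rep W z (\<lambda>u. (1 - t) * \<alpha> u + t * \<beta> u)" using rep_comb[OF ab', of t] t by simp
    then have zero: "(1 - t) * \<alpha> u + t * \<beta> u = 0" if "u \<in> W - {w}" for u
      using ray_unique[OF w c] that by blast
    have "\<alpha> u = 0 \<and> \<beta> u = 0" if u: "u \<in> W - {w}" for u
    proof -
      have "0 \<le> \<alpha> u" "0 \<le> \<beta> u" using ab' u unfolding rep_def by auto
      moreover from this have "0 \<le> (1 - t) * \<alpha> u" "0 \<le> t * \<beta> u" using t by auto
      ultimately have "(1 - t) * \<alpha> u = 0" "t * \<beta> u = 0" using zero[OF u] by linarith+
      then show ?thesis using t by simp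
    qed
    then show "a \<in> R w" "b \<in> R w" unfolding R_def using ab ab' by blast+
  qed
  have R_above: "F \<subset> R w" if w: "w \<in> W" for w
  proof
    show "F \<subseteq> R w"
    proof
      fix x assume "x \<in> F"
      then have "rep W x (\<lambda>_. 0)" unfolding rep_def using LF by simp
      then show "x \<in> R w" unfolding R_def using \<open>x \<in> F\<close> FG by auto
    qed
    have "(\<Sum>u\<in>W. (if u = w then 1 else 0) *\<^sub>R (u - f0)) = w - f0"
      using fW w by (simp add: if_distrib[of "\<lambda>c. c *\<^sub>R _"] sum.delta cong: if_cong)
    then have "rep W w (\<lambda>u. if u = w then 1 else 0)"
      unfolding rep_def using subspace_0[OF L] by simp
    then have "w \<in> R w"
      unfolding R_def using w WV VG by (auto intro!: exI[of _ "\<lambda>u. if u = w then 1 else 0"] split: if_splits)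
    then show "F \<noteq> R w" using w WV by blast
  qed
  have "\<not> W \<subseteq> {w}" for w
  proof
    assume Ww: "W \<subseteq> {w}"
    have "G \<subseteq> affine hull (insert w F)"
    proof
      fix z assume "z \<in> G"
      then obtain c where "rep W z c" using W unfolding gen_def by blast
      then have "z - f0 - (\<Sum>u\<in>W. c u *\<^sub>R (u - f0)) \<in> L" unfolding rep_def by blast
      moreover let ?S = "span ((\<lambda>x. -f0 + x) ` insert w F)"
      have "L \<subseteq> ?S" unfolding L_def by (intro span_mono) auto
      moreover have "(\<Sum>u\<in>W. c u *\<^sub>R (u - f0)) \<in> ?S"
        using Ww by (intro span_sum span_scale span_base) auto
      ultimately have "(z - f0 - (\<Sum>u\<in>W. c u *\<^sub>R (u - f0))) + (\<Sum>u\<in>W. c u *\<^sub>R (u - f0)) \<in> ?S"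
        by (intro span_add) auto
      then have "z - f0 \<in> ?S" by simp
      moreover have "f0 \<in> affine hull (insert w F)" using f0 by (intro hull_inc) simp
      moreover have "z = f0 + (z - f0)" by simp
      ultimately show "z \<in> affine hull (insert w F)" using affine_hull_span_gen by blast
    qed
    then show False using dim by blast
  qed
  then have nW: "\<not> W \<subseteq> {w}" for w .
  have "W \<noteq> {}" using nW by blast
  then obtain w where "w \<in> W" by blast
  moreover obtain w' where "w' \<in> W" "w' \<noteq> w" using nW[of w] by blast
  ultimately obtain w w' where ww: "w \<in> W" "w' \<in> W" "w \<noteq> w'" by blast
  have "y \<notin> R w \<or> y \<notin> R w'"
  proof (rule ccontr)
    assume "\<not> ?thesis"
    then obtain c c' where c: "rep W y c" "\<forall>u\<in>W - {w}. c u = 0" and c': "rep W y c'" "\<forall>u\<in>W - {w'}. c' u = 0"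
      unfolding R_def by blast
    have "c' u = 0" if "u \<in> W" for u
      using ray_unique[OF ww(1) c c'(1) that] c'(2) that ww by (cases "u = w") auto
    then have "y - f0 \<in> L" using c'(1) unfolding rep_def by simp
    then show False using inF y by blast
  qed
  then show ?thesis using that R_face R_above ww by blast
qed

text \<open>
  A face that is maximal among the faces containing \<open>H\<close> and missing \<open>y\<close> is a facet, since otherwise
  \<open>larger_face_avoiding\<close> would enlarge it.
\<close>

lemma facet_separating:
  assumes G: "polytope G" and H: "H face_of G" "H \<noteq> {}" and y: "y \<in> G" "y \<notin> H"
  obtains F where "F \<in> facets G" "H \<subseteq> F" "y \<notin> F"
proof -
  define \<F> where "\<F> = {F. F face_of G \<and> H \<subseteq> F \<and> y \<notin> F}"
  have "finite \<F>" unfolding \<F>_def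
    using finite_faces_of_polytope[OF G] by (rule finite_subset[rotated]) auto
  moreover have "H \<in> \<F>" unfolding \<F>_def using H y by auto
  then have "\<F> \<noteq> {}" by blast
  ultimately obtain F where F\<F>: "F \<in> \<F>" and max: "\<And>F'. F' \<in> \<F> \<Longrightarrow> F \<subseteq> F' \<Longrightarrow> F = F'"
    using finite_has_maximal[of \<F>] by metis
  then have F: "F face_of G" "H \<subseteq> F" "y \<notin> F" unfolding \<F>_def by blast+
  have "\<exists>w. G \<subseteq> affine hull (insert w F)"
  proof (rule ccontr)
    assume "\<not> ?thesis"
    then obtain F' where "F' face_of G" "F \<subset> F'" "y \<notin> F'"
      using larger_face_avoiding[OF G, of F y] F H(2) y(1) by blast
    then have "F' \<in> \<F>" unfolding \<F>_def using F by blast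
    then show False using max[of F'] \<open>F \<subset> F'\<close> by blast
  qed
  then obtain w where w: "G \<subseteq> affine hull (insert w F)" by blast
  have pF: "polytope F" using polytope_face_of[OF G F(1)] .
  have "affine_dim F < affine_dim G" using face_of_affine_dim_less[OF G F(1)] F y(1) by blast
  moreover have "affine_dim G \<le> affine_dim F + 1" by (rule affine_dim_le_insert[OF pF G w])
  ultimately show ?thesis using that[of F] F unfolding facets_def by auto
qed

lemma finite_facets: "polytope G \<Longrightarrow> finite (facets G)"
  using finite_faces_of_polytope[of G] unfolding facets_def by (rule finite_subset[rotated]) auto

lemma facets_face_of: "F \<in> facets G \<Longrightarrow> F face_of G"
  unfolding facets_def by blast

lemma facets_affine_dim: "F \<in> facets G \<Longrightarrow> affine_dim F = affine_dim G - 1"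
  unfolding facets_def by blast

lemma facets_nonempty:
  assumes "polytope Q" "Q \<noteq> {}" shows "facets Q \<noteq> {}"
proof -
  obtain x where x: "x extreme_point_of Q" using extreme_point_exists_polytope[OF assms] by blast
  show ?thesis
  proof (cases "Q = {x}")
    case True
    then have "{} \<in> facets Q" unfolding facets_def by (simp add: affine_dim_empty affine_dim_singleton)
    then show ?thesis by blast
  next
    case False
    then obtain y where "y \<in> Q" "y \<notin> {x}" using x unfolding extreme_point_of_def by blast
    moreover have "{x} face_of Q" using x by (simp add: face_of_singleton)
    ultimately show ?thesis using facet_separating[OF assms(1), of "{x}" y] by blast
  qed
qed

section \<open>Facets of simple polytopes are prime\<close>

text \<open>
  A minimal face above \<open>G\<close> works: a facet of it that contains \<open>G\<close> can only be \<open>G\<close> itself.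
\<close>

lemma face_covered:
  assumes Q: "polytope Q" and G: "G face_of Q" "G \<noteq> {}" "G \<noteq> Q"
  obtains G' where "G' face_of Q" "G \<subset> G'" "affine_dim G' = affine_dim G + 1"
proof -
  define \<G> where "\<G> = {G'. G' face_of Q \<and> G \<subset> G'}"
  have "finite \<G>" unfolding \<G>_def
    using finite_faces_of_polytope[OF Q] by (rule finite_subset[rotated]) auto
  moreover have "Q \<in> \<G>"
    unfolding \<G>_def using Q G face_of_imp_subset[OF G(1)] by (auto simp: face_of_refl_eq polytope_imp_convex)
  then have "\<G> \<noteq> {}" by blast
  ultimately obtain G' where G'\<G>: "G' \<in> \<G>" and min: "\<And>K. K \<in> \<G> \<Longrightarrow> K \<subseteq> G' \<Longrightarrow> G' = K"
    using finite_has_minimal[of \<G>] by metis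
  then have G': "G' face_of Q" "G \<subset> G'" unfolding \<G>_def by blast+
  obtain y where y: "y \<in> G'" "y \<notin> G" using G'(2) by blast
  have GG': "G face_of G'" using G G' by (simp add: face_of_face[OF G'(1)])
  have pG': "polytope G'" using polytope_face_of[OF Q G'(1)] .
  obtain F where F: "F \<in> facets G'" "G \<subseteq> F" "y \<notin> F"
    using facet_separating[OF pG' GG' G(2) y] by blast
  have FQ: "F face_of Q" "F \<subseteq> G'"
    using facets_face_of[OF F(1)] face_of_face[OF G'(1)] by blast+
  have "F = G"
  proof (rule ccontr)
    assume "F \<noteq> G"
    then have "F \<in> \<G>" unfolding \<G>_def using FQ F(2) by blast
    then have "G' = F" using min FQ(2) by blast
    then show False using F(3) y(1) by blast
  qed
  then show ?thesis using that[OF G'] facets_affine_dim[OF F(1)] by simp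
qed

text \<open>
  Climb from \<open>G\<close> to \<open>Q\<close> in steps of dimension one. Each step loses at least one facet, because a facet
  separates \<open>G\<close> from a point of the next face.
\<close>

lemma facets_above_ge:
  assumes Q: "polytope Q" and G: "G face_of Q" "G \<noteq> {}"
  shows "int (card {F \<in> facets Q. G \<subseteq> F}) \<ge> affine_dim Q - affine_dim G"
  using G
proof (induction "nat (affine_dim Q - affine_dim G)" arbitrary: G rule: less_induct)
  case less
  show ?case
  proof (cases "G = Q")
    case False
    obtain G' where G': "G' face_of Q" "G \<subset> G'" "affine_dim G' = affine_dim G + 1"
      using face_covered[OF Q less.prems(1,2) False] by blast
    have "affine_dim G < affine_dim Q" using face_of_affine_dim_less[OF Q less.prems(1) False] .
    then have IH: "int (card {F \<in> facets Q. G' \<subseteq> F}) \<ge> affine_dim Q - affine_dim G'"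
      using less.hyps[OF _ G'(1)] G' less.prems(2) by auto
    obtain y where y: "y \<in> G'" "y \<notin> G" using G'(2) by blast
    then have "y \<in> Q" using face_of_imp_subset[OF G'(1)] by blast
    then obtain F where F: "F \<in> facets Q" "G \<subseteq> F" "y \<notin> F"
      using facet_separating[OF Q less.prems] y by blast
    have "{F \<in> facets Q. G' \<subseteq> F} \<subset> {F \<in> facets Q. G \<subseteq> F}"
      using G'(2) F y by blast
    then have "card {F \<in> facets Q. G' \<subseteq> F} < card {F \<in> facets Q. G \<subseteq> F}"
      using finite_facets[OF Q] by (intro psubset_card_mono) auto
    then show ?thesis using IH G'(3) by linarith
  qed simp
qed

text \<open>
  Take a minimal face \<open>E\<close> through \<open>x\<close> that is not contained in \<open>F\<close>. All facets of \<open>E\<close> through \<open>x\<close> lie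
  in \<open>F\<close> and hence coincide with \<open>E \<inter> F\<close>. As the facets of \<open>E\<close> through \<open>x\<close> separate \<open>x\<close> from all
  other points, \<open>E \<inter> F\<close> is just \<open>{x}\<close>, and \<open>E\<close> is an edge.
\<close>

lemma edge_leaving_facet:
  assumes Q: "polytope Q" and x: "x extreme_point_of Q" and F: "F \<in> facets Q" "x \<in> F"
  obtains E where "E face_of Q" "x \<in> E" "affine_dim E = 1" "\<not> E \<subseteq> F"
proof -
  define \<E> where "\<E> = {E. E face_of Q \<and> x \<in> E \<and> \<not> E \<subseteq> F}"
  have FQ: "F face_of Q" using F(1) by (rule facets_face_of)
  have "F \<noteq> Q" using F(1) unfolding facets_def by auto
  then have "Q \<in> \<E>" unfolding \<E>_def
    using Q x face_of_imp_subset[OF FQ]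
    by (auto simp: face_of_refl_eq polytope_imp_convex extreme_point_of_def)
  moreover have "finite \<E>" unfolding \<E>_def
    using finite_faces_of_polytope[OF Q] by (rule finite_subset[rotated]) auto
  ultimately obtain E where E\<E>: "E \<in> \<E>" and min: "\<And>K. K \<in> \<E> \<Longrightarrow> K \<subseteq> E \<Longrightarrow> E = K"
    using finite_has_minimal[of \<E>] by (metis empty_iff)
  then have E: "E face_of Q" "x \<in> E" "\<not> E \<subseteq> F" unfolding \<E>_def by blast+
  have pE: "polytope E" using polytope_face_of[OF Q E(1)] .
  have xE: "{x} face_of E"
    using x E by (simp add: face_of_singleton extreme_point_of_face[OF E(1)])
  have EF: "E \<inter> F face_of E" using face_of_Int[OF E(1) FQ] by (simp add: face_of_face[OF E(1)])
  have pEF: "polytope (E \<inter> F)" using polytope_face_of[OF pE EF] .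
  have facets_E: "K = E \<inter> F" if K: "K \<in> facets E" "x \<in> K" for K
  proof (rule ccontr)
    assume ne: "K \<noteq> E \<inter> F"
    have KE: "K face_of E" using K(1) by (rule facets_face_of)
    then have KQ: "K face_of Q" "K \<subseteq> E" using face_of_face[OF E(1)] by blast+
    have "K \<noteq> E" using K(1) unfolding facets_def by auto
    then have "K \<notin> \<E>" using min KQ(2) by blast
    then have "K \<subseteq> E \<inter> F" using KQ K(2) unfolding \<E>_def by blast
    then have "K face_of (E \<inter> F)" using KE by (simp add: face_of_face[OF EF])
    then have "affine_dim K < affine_dim (E \<inter> F)"
      using face_of_affine_dim_less[OF pEF] ne by blast
    moreover have "affine_dim (E \<inter> F) < affine_dim E"
      using face_of_affine_dim_less[OF pE EF] E(3) by blast
    ultimately show False using facets_affine_dim[OF K(1)] by simp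
  qed
  obtain y where y: "y \<in> E" "y \<notin> F" using E(3) by blast
  have "y \<notin> {x}" using y F(2) by blast
  then obtain K where K: "K \<in> facets E" "{x} \<subseteq> K"
    using facet_separating[OF pE xE _ y(1)] by blast
  have "E \<inter> F = {x}"
  proof (rule ccontr)
    assume "E \<inter> F \<noteq> {x}"
    then obtain z where z: "z \<in> E \<inter> F" "z \<noteq> x" using E(2) F(2) by blast
    then obtain K' where "K' \<in> facets E" "{x} \<subseteq> K'" "z \<notin> K'"
      using facet_separating[OF pE xE, of z] by blast
    then show False using facets_E z(1) by blast
  qed
  then have "{x} \<in> facets E" using facets_E K by auto
  then have "affine_dim E = 1" using facets_affine_dim[of "{x}" E] affine_dim_singleton[of x] by simp
  then show ?thesis using that E by blast
qed

text \<open>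
  Let \<open>x\<close> be a vertex of \<open>G \<inter> H\<close> and \<open>E\<close> an edge at \<open>x\<close> that leaves \<open>F\<close>. An edge lies in at
  least \<open>d - 1\<close> facets, where \<open>d\<close> is the dimension of \<open>Q\<close>, and only \<open>d\<close> facets contain \<open>x\<close>. So \<open>E\<close> lies in
  all facets through \<open>x\<close> except \<open>F\<close>. Since a face is the intersection of the facets above it,
  \<open>E\<close> lies in every face through \<open>x\<close> that is not contained in \<open>F\<close>. If neither \<open>G\<close> nor \<open>H\<close> were
  contained in \<open>F\<close>, then \<open>E \<subseteq> G \<inter> H \<subseteq> F\<close>.
\<close>

lemma simple_polytope_facet_prime:
  assumes Q: "simple_polytope Q" and F: "F \<in> facets Q"
    and G: "G face_of Q" and H: "H face_of Q" and GH: "G \<inter> H \<noteq> {}" "G \<inter> H \<subseteq> F"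
  shows "G \<subseteq> F \<or> H \<subseteq> F"
proof (rule ccontr)
  assume nsub: "\<not> ?thesis"
  have pQ: "polytope Q" using Q unfolding simple_polytope_def by blast
  have GHQ: "G \<inter> H face_of Q" using G H by (rule face_of_Int)
  obtain x where "x extreme_point_of (G \<inter> H)"
    using extreme_point_exists_polytope[OF polytope_face_of[OF pQ GHQ] GH(1)] by blast
  then have x: "x extreme_point_of Q" "x \<in> G" "x \<in> H" "x \<in> F"
    using extreme_point_of_face[OF GHQ] GH(2) by blast+
  obtain E where E: "E face_of Q" "x \<in> E" "affine_dim E = 1" "\<not> E \<subseteq> F"
    using edge_leaving_facet[OF pQ x(1) F x(4)] by blast
  define \<I> where "\<I> = {F \<in> facets Q. x \<in> F}"
  have card\<I>: "int (card \<I>) = affine_dim Q" using Q x(1) unfolding simple_polytope_def \<I>_def by blast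
  have fin: "finite \<I>" unfolding \<I>_def using finite_facets[OF pQ] by simp
  have sub: "{F \<in> facets Q. E \<subseteq> F} \<subseteq> \<I> - {F}" unfolding \<I>_def using E(2,4) by blast
  have "F \<in> \<I>" unfolding \<I>_def using F x(4) by blast
  then have "card (\<I> - {F}) = card \<I> - 1" "card \<I> > 0" using fin by (auto simp: card_gt_0_iff)
  moreover have "int (card {F \<in> facets Q. E \<subseteq> F}) \<ge> affine_dim Q - 1"
    using facets_above_ge[OF pQ E(1)] E(2,3) by auto
  ultimately have "card (\<I> - {F}) \<le> card {F \<in> facets Q. E \<subseteq> F}" using card\<I> by linarith
  then have eq: "{F \<in> facets Q. E \<subseteq> F} = \<I> - {F}" using sub fin by (intro card_seteq) auto
  have above: "E \<subseteq> K" if K: "K face_of Q" "x \<in> K" "\<not> K \<subseteq> F" for K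
  proof
    fix z assume z: "z \<in> E"
    show "z \<in> K"
    proof (rule ccontr)
      assume "z \<notin> K"
      moreover have "z \<in> Q" using z face_of_imp_subset[OF E(1)] by blast
      ultimately obtain F' where F': "F' \<in> facets Q" "K \<subseteq> F'" "z \<notin> F'"
        using facet_separating[OF pQ K(1), of z] K(2) by blast
      then have "F' \<in> \<I> - {F}" unfolding \<I>_def using K(2,3) by blast
      then show False using eq z F'(3) by blast
    qed
  qed
  then have "E \<subseteq> G \<inter> H" using G H x nsub by blast
  then show False using GH(2) E(4) by blast
qed

section \<open>Simplices\<close>

text \<open>
  Every face is the convex hull of the vertices on it, so it is a facet just if it misses exactly
  one vertex.
\<close>

lemma affine_independent_facets:
  assumes S: "finite S" "\<not> affine_dependent S"
  shows "facets (convex hull S) = (\<lambda>v. convex hull (S - {v})) ` S"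
proof -
  have dim: "affine_dim (convex hull C) = int (card C) - 1" if "C \<subseteq> S" for C
    using affine_dim_eq_card[of C "convex hull C"] that S affine_independent_subset finite_subset
    by (metis affine_hull_convex_hull)
  have "convex hull (S - {v}) face_of convex hull S" if "v \<in> S" for v
  proof (rule face_of_convex_hulls)
    have "S - (S - {v}) = {v}" using that by blast
    then show "affine hull (S - {v}) \<inter> convex hull (S - (S - {v})) = {}"
      using S(2) that unfolding affine_dependent_def by auto
  qed (use S in auto)
  then have "convex hull (S - {v}) \<in> facets (convex hull S)" if "v \<in> S" for v
    unfolding facets_def using dim[of S] dim[of "S - {v}"] that S(1) card_Suc_Diff1[OF S(1) that] by auto
  moreover have "\<exists>v\<in>S. F = convex hull (S - {v})" if "F \<in> facets (convex hull S)" for F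
  proof -
    have F: "F = convex hull (F \<inter> S)"
      using face_of_convex_hull_Int[OF S(1) facets_face_of[OF that]] .
    have "int (card (F \<inter> S)) - 1 = int (card S) - 1 - 1"
      using facets_affine_dim[OF that] dim[of S] dim[of "F \<inter> S"] F by simp
    then have "card (F \<inter> S) < card S" by linarith
    then have "\<not> S \<subseteq> F" by (metis Int_absorb1 less_irrefl)
    then obtain v where v: "v \<in> S" "v \<notin> F" by blast
    have "card (S - {v}) = card (F \<inter> S)"
      using card_Suc_Diff1[OF S(1) v(1)] \<open>int (card (F \<inter> S)) - 1 = _\<close> by linarith
    then have "F \<inter> S = S - {v}" using v S(1) by (intro card_seteq) auto
    then show ?thesis using F v(1) by auto
  qed
  ultimately show ?thesis by blast
qed

lemma affine_independent_simple_polytope: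
  assumes S: "finite S" "\<not> affine_dependent S"
  shows "simple_polytope (convex hull S)" and "card (facets (convex hull S)) = card S"
proof -
  have mem: "x \<in> convex hull (S - {v}) \<longleftrightarrow> x \<noteq> v" if "x \<in> S" for x v
    using that S(2) convex_hull_subset_affine_hull[of "S - {x}"]
    unfolding affine_dependent_def by (cases "x = v") (auto intro: hull_inc)
  have inj: "inj_on (\<lambda>v. convex hull (S - {v})) S"
    using mem by (metis (mono_tags, lifting) inj_onI)
  show "card (facets (convex hull S)) = card S"
    unfolding affine_independent_facets[OF S] using inj by (rule card_image)
  have dim: "affine_dim (convex hull S) = int (card S) - 1"
    using S by (intro affine_dim_eq_card) auto
  have "int (card {F \<in> facets (convex hull S). x \<in> F}) = affine_dim (convex hull S)"
    if "x extreme_point_of convex hull S" for x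
  proof -
    have x: "x \<in> S" using that by (rule extreme_point_of_convex_hull)
    have "{F \<in> facets (convex hull S). x \<in> F} = (\<lambda>v. convex hull (S - {v})) ` (S - {x})"
      unfolding affine_independent_facets[OF S] using mem[OF x] by blast
    then have "card {F \<in> facets (convex hull S). x \<in> F} = card (S - {x})"
      using inj by (simp add: card_image inj_on_subset[OF inj])
    then show ?thesis using dim card_Suc_Diff1[OF S(1) x] by simp
  qed
  then show "simple_polytope (convex hull S)"
    unfolding simple_polytope_def using S(1) polytope_convex_hull by blast
qed

text \<open>
  The unit sequences \<open>e i\<close> for \<open>i < card X\<close> are the vertices of a simplex, and they can be mapped linearly
  to the elements of \<open>X\<close> in any order.
\<close>

lemma convex_hull_finite_simplex_extension:
  fixes X :: "'a::real_vector set"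
  assumes "finite X"
  obtains Q :: "(nat \<Rightarrow>\<^sub>0 real) set"
  where "simple_polytope Q" "extension_of Q (convex hull X)" "card (facets Q) = card X"
proof -
  define n where "n = card X"
  obtain h where h: "bij_betw h {..<n} X"
    using ex_bij_betw_nat_finite[OF assms] unfolding n_def by (auto simp: atLeast0LessThan)
  define e where "e i = (Poly_Mapping.single i 1 :: nat \<Rightarrow>\<^sub>0 real)" for i
  define S where "S = e ` {..<n}"
  have lookup_scaleR: "Poly_Mapping.lookup (c *\<^sub>R x) i = c * Poly_Mapping.lookup x i"
    for c and x :: "nat \<Rightarrow>\<^sub>0 real" and i
    by (simp add: scaleR_poly_mapping_def Poly_Mapping.map.rep_eq when_def)
  have inj: "inj_on e A" for A
    unfolding e_def by (rule inj_onI) (metis lookup_single_eq lookup_single_not_eq zero_neq_one)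
  have fS: "finite S" and cS: "card S = n"
    unfolding S_def using card_image[OF inj] by simp_all
  have "\<not> affine_dependent S"
  proof
    assume "affine_dependent S"
    then obtain U v where v: "v \<in> S" "U v \<noteq> 0" "(\<Sum>v\<in>S. U v *\<^sub>R v) = 0"
      unfolding affine_dependent_explicit_finite[OF fS] by blast
    from v(1) obtain j where j: "j < n" "v = e j" unfolding S_def by blast
    have "0 = (\<Sum>i<n. U (e i) *\<^sub>R e i)" using v(3) unfolding S_def by (simp add: sum.reindex[OF inj])
    then have "0 = Poly_Mapping.lookup (\<Sum>i<n. U (e i) *\<^sub>R e i) j" by (metis lookup_zero)
    also have "\<dots> = (\<Sum>i<n. if i = j then U (e i) else 0)"
      unfolding lookup_sum by (intro sum.cong) (auto simp: lookup_scaleR e_def lookup_single when_def)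
    finally show False using j v(2) by simp
  qed
  note S = affine_independent_simple_polytope[OF fS this]
  define \<pi> where "\<pi> x = (\<Sum>i<n. Poly_Mapping.lookup x i *\<^sub>R h i)" for x :: "nat \<Rightarrow>\<^sub>0 real"
  have lin: "linear \<pi>"
    by (rule linearI) (simp_all add: \<pi>_def lookup_add lookup_scaleR scaleR_add_left sum.distrib scaleR_sum_right)
  have \<pi>e: "\<pi> (e j) = h j" if "j < n" for j
  proof -
    have "\<pi> (e j) = (\<Sum>i<n. if i = j then h i else 0)"
      unfolding \<pi>_def e_def by (intro sum.cong) (auto simp: lookup_single when_def)
    then show ?thesis using that by simp
  qed
  have "\<pi> ` S = h ` {..<n}" unfolding S_def image_image by (rule image_cong) (auto simp: \<pi>e)
  then have "\<pi> ` S = X" using h unfolding bij_betw_def by simp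
  then have "\<pi> ` (convex hull S) = convex hull X" using convex_hull_linear_image[OF lin] by metis
  then have "extension_of (convex hull S) (convex hull X)"
    unfolding extension_of_def using lin polytope_convex_hull[OF fS] by blast
  then show ?thesis using that[OF S(1)] S(2) cS n_def by simp
qed

section \<open>Paths in acyclic digraphs\<close>

locale st_dag = fin_digraph D for D :: "('v, 'e::finite) pre_digraph" (structure) +
  fixes s t :: 'v
  assumes acyclic: "\<not> (\<exists>c. cycle c)"
    and s_verts: "s \<in> verts D" and t_verts: "t \<in> verts D" and s_neq_t: "s \<noteq> t"
begin

abbreviation st_path :: "'e list \<Rightarrow> bool" where "st_path p \<equiv> apath s p t"

lemma no_closed_walk: "awalk u p u \<Longrightarrow> p = []"
  using acyclic closed_w_imp_cycle[of p] unfolding closed_w_def by auto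

lemma awalk_imp_apath: "awalk u p v \<Longrightarrow> apath u p v"
  using awalk_not_distinct_decomp[of u p v] no_closed_walk unfolding apath_def by fastforce

lemma apath_inj_on_tail:
  assumes "apath u p v" shows "inj_on (tail D) (set p)"
  using assms unfolding apath_def awalk_verts_conv by (auto split: if_splits simp: distinct_map)

lemma apath_inj_on_head:
  assumes "apath u p v" shows "inj_on (head D) (set p)"
proof -
  have "cas u p v" using assms unfolding apath_def by auto
  then show ?thesis
    using assms awalk_verts_conv'[of u p v] unfolding apath_def by (auto split: if_splits simp: distinct_map)
qed

lemma apath_same_tail:
  "apath u p v \<Longrightarrow> e \<in> set p \<Longrightarrow> f \<in> set p \<Longrightarrow> tail D e = tail D f \<Longrightarrow> e = f"
  using apath_inj_on_tail by (auto dest: inj_onD)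

lemma apath_same_head:
  "apath u p v \<Longrightarrow> e \<in> set p \<Longrightarrow> f \<in> set p \<Longrightarrow> head D e = head D f \<Longrightarrow> e = f"
  using apath_inj_on_head by (auto dest: inj_onD)

text \<open>
  The first arcs in which the two paths differ have the same tail. Neither path can be a proper initial
  segment of the other, as a path does not visit its end vertex before its end.
\<close>

lemma apaths_diverge:
  assumes "apath u r v" "apath u p v" "r \<noteq> p"
  obtains e f where "e \<in> set r" "f \<in> set p" "e \<noteq> f" "tail D e = tail D f"
  using assms
proof (induction r arbitrary: p u thesis)
  case Nil
  then show ?case using apath_nonempty_ends by (auto simp: apath_Nil_iff)
next
  case (Cons e es)
  from Cons.prems obtain f fs where p: "p = f # fs"
    using apath_nonempty_ends[of u "e # es" v] by (cases p) (auto simp: apath_Nil_iff)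
  show ?case
  proof (cases "e = f")
    case True
    then have "apath (head D e) es v" "apath (head D e) fs v" "es \<noteq> fs"
      using Cons.prems p by (auto simp: apath_Cons_iff)
    then show ?thesis using Cons.IH Cons.prems(1) p by (metis list.set_intros(2))
  next
    case False
    then show ?thesis
      using Cons.prems(1)[of e f] Cons.prems(2,3) p by (simp add: apath_Cons_iff)
  qed
qed

lemma apath_subset_imp_eq:
  assumes "apath u r v" "apath u p v" "set r \<subseteq> set p"
  shows "r = p"
  using apaths_diverge[OF assms(1,2)] apath_same_tail[OF assms(2)] assms(3) by (metis subsetD)

lemma apath_through:
  assumes "apath u p v" "a \<in> set (awalk_verts u p)" "a \<noteq> u" "a \<noteq> v"
  obtains e f where "e \<in> set p" "f \<in> set p" "head D e = a" "tail D f = a"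
proof -
  obtain q r where qr: "p = q @ r" "awalk u q a" "awalk a r v"
    using awalk_decomp assms(1,2) unfolding apath_def by blast
  have "q \<noteq> []" "r \<noteq> []" using qr assms(3,4) by (auto simp: awalk_Nil_iff)
  moreover have "head D (last q) = a"
    using qr(2) \<open>q \<noteq> []\<close> awlast_of_awalk[OF qr(2)] by (auto simp: awalk_verts_conv awalk_conv)
  moreover have "tail D (hd r) = a"
    using qr(3) \<open>r \<noteq> []\<close> by (cases r) (auto simp: awalk_Cons_iff)
  ultimately show ?thesis using that[of "last q" "hd r"] qr(1) by auto
qed

lemma list_change_adjacent:
  assumes "x \<in> set xs" "x \<in> C" "y \<in> set xs" "y \<notin> C"
  obtains us a b vs where "xs = us @ a # b # vs" "(a \<in> C) \<noteq> (b \<in> C)"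
  using assms
proof (induction xs arbitrary: x y thesis)
  case (Cons z zs)
  show ?case
  proof (cases "(\<exists>x\<in>set zs. x \<in> C) \<and> (\<exists>y\<in>set zs. y \<notin> C)")
    case True
    then obtain x' y' where "x' \<in> set zs" "x' \<in> C" "y' \<in> set zs" "y' \<notin> C" by blast
    then obtain us a b vs where "zs = us @ a # b # vs" "(a \<in> C) \<noteq> (b \<in> C)"
      using Cons.IH by blast
    then show ?thesis using Cons.prems(1)[of "z # us"] by simp
  next
    case False
    then obtain z' zs' where "zs = z' # zs'" using Cons.prems by (cases zs) auto
    then show ?thesis using Cons.prems(1)[of "[]" z z' zs'] False Cons.prems(2-) by auto
  qed
qed simp

text \<open>
  Going along the path, membership in \<open>C\<close> changes between two consecutive arcs, and \<open>a\<close> is the vertex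
  between them. One of the two arcs is in \<open>C\<close> and the other is not, and they are the only
  arcs of the path at \<open>a\<close>.
\<close>

lemma apath_boundary_vertex:
  assumes q: "apath u q v" and C: "C \<subset> set q" "C \<noteq> {}"
  obtains a where "a \<in> verts D - {u, v}"
    and "\<exists>e\<in>C. head D e = a \<or> tail D e = a"
    and "\<And>e f. e \<in> C \<Longrightarrow> f \<in> C \<Longrightarrow> head D e = a \<Longrightarrow> tail D f = a \<Longrightarrow> False"
proof -
  obtain x y where "x \<in> set q" "x \<in> C" "y \<in> set q" "y \<notin> C" using C by blast
  then obtain us e f vs where ef: "q = us @ e # f # vs" "(e \<in> C) \<noteq> (f \<in> C)"
    by (rule list_change_adjacent)
  have aw: "awalk u ((us @ [e]) @ (f # vs)) v" using q ef(1) unfolding apath_def by simp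
  define a where "a = awlast u (us @ [e])"
  have 1: "awalk u (us @ [e]) a" and 2: "awalk a (f # vs) v"
    using aw unfolding awalk_append_iff a_def by auto
  have he: "head D e = a" unfolding a_def by (simp add: awalk_verts_conv)
  have tf: "tail D f = a" using 2 by (simp add: awalk_Cons_iff)
  have "a \<noteq> u" using 1 no_closed_walk by blast
  moreover have "a \<noteq> v" using 2 no_closed_walk by blast
  moreover have "a \<in> verts D" using 2 by (rule awalk_hd_in_verts)
  moreover have "\<exists>e\<in>C. head D e = a \<or> tail D e = a" using ef(2) he tf by blast
  moreover have False if "e' \<in> C" "f' \<in> C" "head D e' = a" "tail D f' = a" for e' f'
  proof -
    have "e' = e" using apath_same_head[OF q, of e' e] that C(1) he ef(1) by auto
    moreover have "f' = f" using apath_same_tail[OF q, of f' f] that C(1) tf ef(1) by auto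
    ultimately show False using ef(2) that by blast
  qed
  ultimately show ?thesis using that by blast
qed

text \<open>
  Assume that at least two paths are missed, and let \<open>C\<close> be the set of arcs common to all missed paths.
  
  For a path \<open>p\<close> in \<open>J\<close>, let \<open>S\<close> be a minimal set of arcs above \<open>p\<close> that is not in \<open>J\<close>. For every
  missed path \<open>w\<close>, primality applied to \<open>S \<inter> (p \<union> w)\<close> yields \<open>S \<subseteq> p \<union> w\<close>; hence \<open>S \<subseteq> p \<union> C\<close>. By
  minimality, every arc of \<open>S\<close> outside of \<open>p\<close> lies on some path within \<open>S\<close>. So some path \<open>r\<close> uses an
  arc of \<open>C\<close> that is not on \<open>p\<close> and otherwise only arcs of \<open>p\<close> and \<open>C\<close>.
  
  In particular \<open>C\<close> is nonempty, and it is not a whole path because two paths are missed. So there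
  is an inner vertex \<open>a\<close> at which \<open>C\<close> has an arc, but which no path can pass using only arcs of \<open>C\<close>. Among
  the paths that avoid \<open>a\<close>, choose \<open>p\<close> with as few arcs outside of \<open>C\<close> as possible. It does not
  contain \<open>C\<close>, so it is in \<open>J\<close> and has a path \<open>r\<close> as above, which again avoids \<open>a\<close>. By the choice of \<open>p\<close>,
  the paths \<open>p\<close> and \<open>r\<close> have the same arcs outside of \<open>C\<close>. Where they diverge, both therefore continue
  in \<open>C\<close>, in two different arcs with the same tail; but \<open>C\<close> is part of a single path.
\<close>

theorem prime_ideal_misses_one_path:
  assumes avoid: "\<And>v. v \<in> verts D - {s, t} \<Longrightarrow> \<exists>p. st_path p \<and> v \<notin> set (awalk_verts s p)"
    and down: "\<And>S T. S \<subseteq> T \<Longrightarrow> J T \<Longrightarrow> J S"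
    and prime: "\<And>S T w. st_path w \<Longrightarrow> set w \<subseteq> S \<inter> T \<Longrightarrow> J (S \<inter> T) \<Longrightarrow> J S \<or> J T"
    and unused: "\<And>S f. (\<And>r. st_path r \<Longrightarrow> set r \<subseteq> S \<Longrightarrow> f \<notin> set r) \<Longrightarrow> J (S - {f}) \<Longrightarrow> J S"
    and u: "st_path u" "J (set u)"
    and v: "st_path v" "\<not> J (set v)" and q: "st_path q" "\<not> J (set q)"
  shows "q = v"
proof (rule ccontr)
  assume "q \<noteq> v"
  define W where "W = {w. st_path w \<and> \<not> J (set w)}"
  define C where "C = (\<Inter>w\<in>W. set w)"
  have CW: "C \<subseteq> set w" if "st_path w" "\<not> J (set w)" for w
    unfolding C_def W_def using that by blast
  have step: "\<exists>r f. st_path r \<and> set r \<subseteq> set p \<union> C \<and> f \<in> set r \<inter> C \<and> f \<notin> set p"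
    if p: "st_path p" "J (set p)" for p
  proof -
    define \<S> where "\<S> S \<longleftrightarrow> set p \<subseteq> S \<and> \<not> J S" for S
    have "\<S> UNIV" unfolding \<S>_def using down[of "set v" UNIV] v(2) by blast
    then obtain S where S: "\<S> S" and min: "\<And>S'. \<S> S' \<Longrightarrow> card S \<le> card S'"
      using ex_has_least_nat[of \<S> UNIV card] by blast
    have pS: "set p \<subseteq> S" and nJ: "\<not> J S" using S unfolding \<S>_def by blast+
    have "S \<subseteq> set p \<union> set w" if w: "st_path w" "\<not> J (set w)" for w
    proof -
      have "\<not> J (S \<inter> (set p \<union> set w))"
        using prime[OF p(1), of S "set p \<union> set w"] pS nJ down[of "set w" "set p \<union> set w"] w(2) by blast
      then have "card S \<le> card (S \<inter> (set p \<union> set w))"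
        using pS by (intro min) (auto simp: \<S>_def)
      then have "S \<inter> (set p \<union> set w) = S" by (intro card_seteq) auto
      then show ?thesis by blast
    qed
    then have SC: "S \<subseteq> set p \<union> C" unfolding C_def W_def by blast
    have "S \<noteq> set p" using nJ p(2) by blast
    then obtain f where f: "f \<in> S" "f \<notin> set p" using pS by blast
    have "card (S - {f}) < card S" using f(1) by (intro psubset_card_mono) auto
    then have "\<not> \<S> (S - {f})" using min[of "S - {f}"] by linarith
    then have "J (S - {f})" unfolding \<S>_def using pS f(2) by blast
    then obtain r where "st_path r" "set r \<subseteq> S" "f \<in> set r" using unused[of S f] nJ by blast
    then show ?thesis using SC f by blast
  qed
  have C0: "C \<noteq> {}" using step[OF u] by blast
  have Cq: "C \<subset> set q"
  proof
    show "C \<subseteq> set q" using CW[OF q] .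
    show "C \<noteq> set q" using CW[OF v] apath_subset_imp_eq[OF q(1) v(1)] \<open>q \<noteq> v\<close> by blast
  qed
  obtain a where a: "a \<in> verts D - {s, t}" "\<exists>e\<in>C. head D e = a \<or> tail D e = a"
    and a_once: "\<And>e f. e \<in> C \<Longrightarrow> f \<in> C \<Longrightarrow> head D e = a \<Longrightarrow> tail D f = a \<Longrightarrow> False"
    using apath_boundary_vertex[OF q(1) Cq C0] by blast
  define \<A> where "\<A> p \<longleftrightarrow> st_path p \<and> a \<notin> set (awalk_verts s p)" for p
  have off: "head D e \<noteq> a" "tail D e \<noteq> a" if "\<A> p" "e \<in> set p" for p e
    using that set_awalk_verts[of s p t] unfolding \<A>_def apath_def by auto
  obtain p0 where "\<A> p0" using avoid[OF a(1)] unfolding \<A>_def by blast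
  then obtain p where p: "\<A> p" and min: "\<And>p'. \<A> p' \<Longrightarrow> card (set p - C) \<le> card (set p' - C)"
    using ex_has_least_nat[of \<A> p0 "\<lambda>p. card (set p - C)"] by blast
  have sp: "st_path p" using p unfolding \<A>_def by blast
  have "J (set p)" using CW[OF sp] off[OF p] a(2) by blast
  then obtain r f where r: "st_path r" "set r \<subseteq> set p \<union> C" "f \<in> set r \<inter> C" "f \<notin> set p"
    using step[OF sp] by blast
  have "a \<notin> set (awalk_verts s r)"
  proof
    assume "a \<in> set (awalk_verts s r)"
    then obtain e f where "e \<in> set r" "f \<in> set r" "head D e = a" "tail D f = a"
      using apath_through[OF r(1)] a(1) by blast
    then show False using a_once[of e f] off[OF p] r(2) by blast
  qed
  then have "\<A> r" unfolding \<A>_def using r(1) by blast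
  then have "set r - C = set p - C" using min[of r] r(2) by (intro card_seteq) auto
  moreover obtain e g where eg: "e \<in> set r" "g \<in> set p" "e \<noteq> g" "tail D e = tail D g"
    using apaths_diverge[OF r(1) sp] r(3,4) by blast
  ultimately show False
    using apath_same_tail[OF r(1)] apath_same_tail[OF sp] apath_same_tail[OF q(1), of e g] Cq by blast
qed

end

section \<open>The flow polytope as convex hull of the paths\<close>

definition path_vector :: "'e list \<Rightarrow> real ^ 'e::finite" where
  "path_vector p = (\<chi> e. if e \<in> set p then 1 else 0)"

lemma path_vector_nth [simp]: "path_vector p $ e = (if e \<in> set p then 1 else 0)"
  by (simp add: path_vector_def)

context st_dag begin

definition net_outflow :: "real ^ 'e \<Rightarrow> 'v \<Rightarrow> real" where
  "net_outflow y v = (\<Sum>e\<in>out_arcs D v. y $ e) - (\<Sum>e\<in>in_arcs D v. y $ e)"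

text \<open>
  The value \<open>c\<close> may be any real number, so that flows can be decomposed by subtracting multiples of path
  vectors without first bounding these multiples by the value.
\<close>

definition st_flow :: "real \<Rightarrow> real ^ 'e \<Rightarrow> bool" where
  "st_flow c y \<longleftrightarrow> (\<forall>e. e \<notin> arcs D \<longrightarrow> y $ e = 0) \<and> (\<forall>e. 0 \<le> y $ e) \<and>
     (\<forall>v\<in>verts D - {s, t}. net_outflow y v = 0) \<and> net_outflow y s = c"

lemma st_flow_polytope_eq: "st_flow_polytope D s t = {y. st_flow 1 y}"
proof -
  have zero: "(a - b = 0) = (b = a)" for a b :: real by auto
  have "(\<forall>e. e \<notin> arcs D \<longrightarrow> y $ e = 0) \<and> (\<forall>e\<in>arcs D. 0 \<le> y $ e) \<longleftrightarrow>
      (\<forall>e. e \<notin> arcs D \<longrightarrow> y $ e = 0) \<and> (\<forall>e. 0 \<le> y $ e)" for y :: "real ^ 'e"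
    by (metis order.refl)
  then show ?thesis
    unfolding st_flow_polytope_def st_flow_def net_outflow_def zero by blast
qed

lemma sum_net_outflow: "(\<Sum>v\<in>verts D. g v * net_outflow y v) = (\<Sum>e\<in>arcs D. y $ e * (g (tail D e) - g (head D e)))"
proof -
  have "(\<Sum>v\<in>verts D. g v * (\<Sum>e\<in>out_arcs D v. y $ e)) = (\<Sum>v\<in>verts D. \<Sum>e\<in>{e\<in>arcs D. tail D e = v}. g (tail D e) * y $ e)"
    unfolding out_arcs_def by (simp add: sum_distrib_left)
  also have "\<dots> = (\<Sum>e\<in>arcs D. g (tail D e) * y $ e)" by (rule sum.group) auto
  finally have 1: "(\<Sum>v\<in>verts D. g v * (\<Sum>e\<in>out_arcs D v. y $ e)) = (\<Sum>e\<in>arcs D. g (tail D e) * y $ e)" .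
  have "(\<Sum>v\<in>verts D. g v * (\<Sum>e\<in>in_arcs D v. y $ e)) = (\<Sum>v\<in>verts D. \<Sum>e\<in>{e\<in>arcs D. head D e = v}. g (head D e) * y $ e)"
    unfolding in_arcs_def by (simp add: sum_distrib_left)
  also have "\<dots> = (\<Sum>e\<in>arcs D. g (head D e) * y $ e)" by (rule sum.group) auto
  finally have 2: "(\<Sum>v\<in>verts D. g v * (\<Sum>e\<in>in_arcs D v. y $ e)) = (\<Sum>e\<in>arcs D. g (head D e) * y $ e)" .
  show ?thesis unfolding net_outflow_def using 1 2
    by (simp add: right_diff_distrib sum_subtractf mult.commute)
qed

text \<open>
  Summation by parts turns a sum of potential differences along the arcs into one over the
  vertices, where only \<open>s\<close> and \<open>t\<close> contribute. With the constant potential one gets that the net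
  outflow of \<open>t\<close> is \<open>- c\<close>. Indicator functions of cuts and rank functions are the potentials used
  below.
\<close>

lemma st_flow_potential:
  assumes "st_flow c y"
  shows "(\<Sum>e\<in>arcs D. y $ e * (g (tail D e) - g (head D e))) = c * (g s - g t)"
proof -
  have ex: "(\<Sum>v\<in>verts D. g v * net_outflow y v) = g s * c + g t * net_outflow y t" for g
  proof -
    have "(\<Sum>v\<in>verts D. g v * net_outflow y v) = (\<Sum>v\<in>{s, t}. g v * net_outflow y v)"
      using assms s_verts t_verts unfolding st_flow_def by (intro sum.mono_neutral_right) auto
    then show ?thesis using s_neq_t assms unfolding st_flow_def by simp
  qed
  have "net_outflow y t = - c" using ex[of "\<lambda>_. 1"] sum_net_outflow[of "\<lambda>_. 1" y] by simp
  then show ?thesis using ex[of g] by (simp add: sum_net_outflow algebra_simps)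
qed

text \<open>
  Otherwise the vertices reachable from \<open>s\<close> by arcs of positive flow form a cut that no flow leaves, but
  its net outflow is the positive value \<open>c\<close>.
\<close>

lemma st_flow_support_path:
  assumes y: "st_flow c y" and c: "c > 0"
  obtains p where "st_path p" "\<And>e. e \<in> set p \<Longrightarrow> y $ e > 0"
proof -
  define R where "R = {v. \<exists>p. awalk s p v \<and> (\<forall>e\<in>set p. y $ e > 0)}"
  have s: "s \<in> R" unfolding R_def using s_verts by (auto intro!: exI[of _ "[]"] simp: awalk_Nil_iff)
  have "t \<in> R"
  proof (rule ccontr)
    assume t: "t \<notin> R"
    \<comment> \<open>the indicator of the cut as potential\<close>
    define g where "g v = (if v \<in> R then 1 else 0 :: real)" for v
    have "y $ e * (g (tail D e) - g (head D e)) \<le> 0" if e: "e \<in> arcs D" for e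
    proof (cases "y $ e > 0 \<and> tail D e \<in> R")
      case True
      then obtain p where "awalk s p (tail D e)" "\<forall>e\<in>set p. y $ e > 0" unfolding R_def by blast
      then have "awalk s (p @ [e]) (head D e)" "\<forall>f\<in>set (p @ [e]). y $ f > 0"
        using awalk_appendI arc_implies_awalk[OF e] True by auto
      then have "head D e \<in> R" unfolding R_def by blast
      then show ?thesis using True by (simp add: g_def)
    next
      case False
      have "y $ e \<ge> 0" using y unfolding st_flow_def by blast
      then show ?thesis using False by (auto simp: g_def mult_nonneg_nonpos)
    qed
    then have "(\<Sum>e\<in>arcs D. y $ e * (g (tail D e) - g (head D e))) \<le> 0" by (rule sum_nonpos)
    then show False using st_flow_potential[OF y, of g] s t c by (simp add: g_def)
  qed
  then show ?thesis using that awalk_imp_apath unfolding R_def by blast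
qed

text \<open>
  The number \<open>h\<close> of vertices reachable from a vertex decreases strictly along every arc, so the flow has
  nonnegative potential differences, all positive where it is nonzero. Their sum is
  \<open>c * (h s - h t)\<close>, which is at most \<open>0\<close> because \<open>t\<close> is reachable from \<open>s\<close>.
\<close>

lemma st_flow_nonpos_value_eq_0:
  assumes y: "st_flow c y" and c: "c \<le> 0" and p: "st_path p"
  shows "y = 0"
proof -
  define R where "R v = {w. \<exists>q. awalk v q w}" for v
  define h where "h v = real (card (R v))" for v
  have fin: "finite (R v)" for v
    unfolding R_def by (rule finite_subset[of _ "verts D"]) (auto intro: awalk_last_in_verts)
  have mono: "R w \<subseteq> R v" if "awalk v q w" for v q w
    unfolding R_def using that awalk_appendI by blast
  have strict: "h (head D e) < h (tail D e)" if e: "e \<in> arcs D" for e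
  proof -
    have "tail D e \<notin> R (head D e)"
    proof
      assume "tail D e \<in> R (head D e)"
      then obtain q where "awalk (head D e) q (tail D e)" unfolding R_def by blast
      then show False using no_closed_walk[of "tail D e" "[e] @ q"] awalk_appendI arc_implies_awalk[OF e] by blast
    qed
    moreover have "tail D e \<in> R (tail D e)"
      unfolding R_def using e by (auto intro!: exI[of _ "[]"] simp: awalk_Nil_iff)
    ultimately have "R (head D e) \<subset> R (tail D e)" using mono[OF arc_implies_awalk[OF e]] by blast
    then show ?thesis unfolding h_def using fin by (simp add: psubset_card_mono)
  qed
  have "R t \<subseteq> R s" using mono p unfolding apath_def by blast
  then have "h s \<ge> h t" unfolding h_def using fin by (simp add: card_mono)
  then have "c * (h s - h t) \<le> 0" using c by (simp add: mult_nonpos_nonneg)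
  then have le: "(\<Sum>e\<in>arcs D. y $ e * (h (tail D e) - h (head D e))) \<le> 0"
    using st_flow_potential[OF y, of h] by simp
  have nn: "0 \<le> y $ e * (h (tail D e) - h (head D e))" if "e \<in> arcs D" for e
    using y strict[OF that] unfolding st_flow_def by simp
  then have "\<forall>e\<in>arcs D. y $ e * (h (tail D e) - h (head D e)) = 0"
    using le sum_nonneg_eq_0_iff[of "arcs D" "\<lambda>e. y $ e * (h (tail D e) - h (head D e))"]
      sum_nonneg[of "arcs D" "\<lambda>e. y $ e * (h (tail D e) - h (head D e))"] by auto
  then have "y $ e = 0" if "e \<in> arcs D" for e using strict[OF that] that by force
  then have "y $ e = 0" for e using y unfolding st_flow_def by blast
  then show ?thesis by (simp add: vec_eq_iff)
qed

lemma net_outflow_path_vector: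
  assumes "apath u p v"
  shows "net_outflow (path_vector p) x = (if x = u then 1 else 0) - (if x = v then 1 else 0)"
proof -
  have sub: "set p \<subseteq> arcs D" using assms unfolding apath_def by auto
  have "net_outflow (path_vector p) x = (\<Sum>e\<in>set p. (if tail D e = x then 1 else 0) - (if head D e = x then 1 else 0))"
  proof -
    have "(\<Sum>e\<in>out_arcs D x. path_vector p $ e) = (\<Sum>e\<in>set p. if tail D e = x then 1 else 0)"
      using sub by (auto simp: out_arcs_def Int_def simp flip: sum.inter_restrict sum.inter_filter intro!: arg_cong[of _ _ card])
    moreover have "(\<Sum>e\<in>in_arcs D x. path_vector p $ e) = (\<Sum>e\<in>set p. if head D e = x then 1 else 0)"
      using sub by (auto simp: in_arcs_def Int_def simp flip: sum.inter_restrict sum.inter_filter intro!: arg_cong[of _ _ card])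
    ultimately show ?thesis unfolding net_outflow_def by (simp add: sum_subtractf)
  qed
  also have "\<dots> = (if x = u then 1 else 0) - (if x = v then 1 else 0)"
    using assms
  proof (induction p arbitrary: u)
    case (Cons e es)
    have "e \<notin> set es" using Cons.prems awalk_verts_arc1 by (auto simp: apath_Cons_iff)
    then show ?case using Cons.IH[of "head D e"] Cons.prems by (auto simp: apath_Cons_iff)
  qed (auto simp: apath_Nil_iff)
  finally show ?thesis .
qed

lemma st_flow_path_vector: "st_path p \<Longrightarrow> st_flow 1 (path_vector p)"
  using net_outflow_path_vector[of s p t] s_neq_t unfolding st_flow_def apath_def by auto

lemma net_outflow_diff: "net_outflow (y - k *\<^sub>R z) v = net_outflow y v - k * net_outflow z v"
  unfolding net_outflow_def by (simp add: sum_subtractf sum_distrib_left algebra_simps)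

text \<open>
  Subtract from \<open>y\<close> as much as possible of a path in its support; this makes the support smaller. The
  remaining flow might have a nonpositive value, in which case it is zero.
\<close>

lemma flow_decomposition:
  assumes "st_flow c y" "st_path p0"
  shows "\<exists>\<mu>. (\<forall>p. 0 \<le> \<mu> p) \<and> y = (\<Sum>p\<in>{p. st_path p}. \<mu> p *\<^sub>R path_vector p)"
  using assms(1)
proof (induction "card {e. y $ e > 0}" arbitrary: c y rule: less_induct)
  case less
  show ?case
  proof (cases "c > 0")
    case False
    then have "y = 0" using st_flow_nonpos_value_eq_0[OF less.prems _ assms(2)] by simp
    then show ?thesis by (intro exI[of _ "\<lambda>_. 0"]) simp
  next
    case True
    obtain p where p: "st_path p" "\<And>e. e \<in> set p \<Longrightarrow> y $ e > 0"
      using st_flow_support_path[OF less.prems True] by blast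
    have pne: "p \<noteq> []" using p(1) s_neq_t by (auto simp: apath_Nil_iff)
    define k where "k = Min ((\<lambda>e. y $ e) ` set p)"
    have kle: "k \<le> y $ e" if "e \<in> set p" for e unfolding k_def using that by simp
    have "k \<in> (\<lambda>e. y $ e) ` set p" unfolding k_def using pne by (intro Min_in) auto
    then obtain e0 where e0: "e0 \<in> set p" "y $ e0 = k" by blast
    have k: "k > 0" using e0 p(2) by blast
    let ?y = "y - k *\<^sub>R path_vector p"
    have "st_flow (c - k) ?y"
      using less.prems st_flow_path_vector[OF p(1)] kle unfolding st_flow_def net_outflow_diff by auto
    moreover have "{e. ?y $ e > 0} \<subset> {e. y $ e > 0}"
      using e0 k p(2) by (auto split: if_splits)
    then have "card {e. ?y $ e > 0} < card {e. y $ e > 0}" by (intro psubset_card_mono) auto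
    ultimately obtain \<mu> where \<mu>: "\<forall>p. 0 \<le> \<mu> p" "?y = (\<Sum>p\<in>{p. st_path p}. \<mu> p *\<^sub>R path_vector p)"
      using less.hyps by blast
    have "(\<Sum>q\<in>{p. st_path p}. (\<mu>(p := \<mu> p + k)) q *\<^sub>R path_vector q) =
        (\<Sum>q\<in>{p. st_path p}. \<mu> q *\<^sub>R path_vector q + (if q = p then k *\<^sub>R path_vector p else 0))"
      by (intro sum.cong) (auto simp: scaleR_add_left)
    also have "\<dots> = ?y + k *\<^sub>R path_vector p"
      using p(1) apaths_finite[of s t] by (simp add: sum.distrib \<mu>(2) sum.delta)
    finally have "y = (\<Sum>q\<in>{p. st_path p}. (\<mu>(p := \<mu> p + k)) q *\<^sub>R path_vector q)" by simp
    then show ?thesis using \<mu>(1) k by (intro exI[of _ "\<mu>(p := \<mu> p + k)"]) auto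
  qed
qed

lemma st_flow_polytope_path_combination:
  assumes "y \<in> st_flow_polytope D s t"
  obtains \<mu> where "\<And>p. 0 \<le> \<mu> p" "y = (\<Sum>p\<in>{p. st_path p}. \<mu> p *\<^sub>R path_vector p)"
proof -
  have y: "st_flow 1 y" using assms by (simp add: st_flow_polytope_eq)
  then obtain p where "st_path p" using st_flow_support_path[OF y] by auto
  then show ?thesis using flow_decomposition[OF y] that by blast
qed

lemma net_outflow_sum: "net_outflow (\<Sum>i\<in>I. \<mu> i *\<^sub>R z i) v = (\<Sum>i\<in>I. \<mu> i * net_outflow (z i) v)"
proof -
  have swap: "(\<Sum>e\<in>A. (\<Sum>i\<in>I. \<mu> i *\<^sub>R z i) $ e) = (\<Sum>i\<in>I. \<mu> i * (\<Sum>e\<in>A. z i $ e))" for A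
    by (simp add: sum_distrib_left sum.swap[of _ I A])
  show ?thesis unfolding net_outflow_def swap by (simp add: right_diff_distrib sum_subtractf)
qed

lemma path_vector_in_flow_polytope: "st_path p \<Longrightarrow> path_vector p \<in> st_flow_polytope D s t"
  using st_flow_path_vector by (simp add: st_flow_polytope_eq)

lemma st_flow_polytope_eq_convex_hull:
  "st_flow_polytope D s t = convex hull (path_vector ` {p. st_path p})"
proof (rule antisym)
  have "convex (st_flow_polytope D s t)"
    unfolding convex_alt
  proof (intro ballI allI impI)
    fix x y k assume "x \<in> st_flow_polytope D s t" "y \<in> st_flow_polytope D s t" "0 \<le> k \<and> k \<le> (1::real)"
    moreover have "net_outflow ((1 - k) *\<^sub>R x + k *\<^sub>R y) v = (1 - k) * net_outflow x v + k * net_outflow y v" for v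
      unfolding net_outflow_def by (simp add: sum.distrib sum_distrib_left right_diff_distrib)
    ultimately show "(1 - k) *\<^sub>R x + k *\<^sub>R y \<in> st_flow_polytope D s t"
      by (simp add: st_flow_polytope_eq st_flow_def)
  qed
  then show "convex hull (path_vector ` {p. st_path p}) \<subseteq> st_flow_polytope D s t"
    using path_vector_in_flow_polytope by (intro hull_minimal) auto
  show "st_flow_polytope D s t \<subseteq> convex hull (path_vector ` {p. st_path p})"
  proof
    fix y assume y: "y \<in> st_flow_polytope D s t"
    then obtain \<mu> where \<mu>: "\<And>p. 0 \<le> \<mu> p" "y = (\<Sum>p\<in>{p. st_path p}. \<mu> p *\<^sub>R path_vector p)"
      using st_flow_polytope_path_combination by blast
    have "1 = net_outflow y s" using y by (simp add: st_flow_polytope_eq st_flow_def)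
    also have "\<dots> = (\<Sum>p\<in>{p. st_path p}. \<mu> p)"
      unfolding \<mu>(2) net_outflow_sum using net_outflow_path_vector s_neq_t by (intro sum.cong) auto
    finally have "(\<Sum>p\<in>{p. st_path p}. \<mu> p) = 1" by simp
    then show "y \<in> convex hull (path_vector ` {p. st_path p})"
      unfolding \<mu>(2) using \<mu>(1) apaths_finite
      by (intro convex_sum[OF _ convex_convex_hull]) (auto intro: hull_inc)
  qed
qed

text \<open>
  In a decomposition of \<open>y\<close>, a path with positive coefficient that uses \<open>f\<close> lies in the support of \<open>y\<close>.
\<close>

lemma flow_support_path:
  assumes "y \<in> st_flow_polytope D s t" "y $ f \<noteq> 0"
  obtains r where "st_path r" "f \<in> set r" "\<And>e. e \<in> set r \<Longrightarrow> y $ e \<noteq> 0"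
proof -
  obtain \<mu> where \<mu>: "\<And>p. 0 \<le> \<mu> p" "y = (\<Sum>p\<in>{p. st_path p}. \<mu> p *\<^sub>R path_vector p)"
    using st_flow_polytope_path_combination assms(1) by blast
  have y: "y $ e = (\<Sum>p\<in>{p. st_path p}. if e \<in> set p then \<mu> p else 0)" for e
    unfolding \<mu>(2) by (auto intro: sum.cong)
  obtain r where r: "st_path r" "f \<in> set r" "\<mu> r \<noteq> 0"
  proof -
    have "(\<Sum>p\<in>{p. st_path p}. if f \<in> set p then \<mu> p else 0) \<noteq> 0" using assms(2) y by simp
    then obtain r where "r \<in> {p. st_path p}" "(if f \<in> set r then \<mu> r else 0) \<noteq> 0"
      by (rule sum.not_neutral_contains_not_neutral)
    then show ?thesis using that[of r] by (auto split: if_splits)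
  qed
  have "y $ e \<noteq> 0" if "e \<in> set r" for e
  proof -
    have "0 < y $ e" unfolding y using r \<mu>(1) that apaths_finite
      by (intro sum_pos2[of _ r]) (auto simp: order_less_le)
    then show ?thesis by simp
  qed
  then show ?thesis using that r by blast
qed

end

section \<open>One facet for every path\<close>

context st_dag begin

lemma path_vector_inj: "inj_on path_vector {p. st_path p}"
proof (rule inj_onI)
  fix p q assume pq: "p \<in> {p. st_path p}" "q \<in> {p. st_path p}" "path_vector p = (path_vector q :: real ^ 'e)"
  have "set p = set q"
  proof (rule set_eqI)
    fix e
    have "path_vector p $ e = path_vector q $ e" using pq(3) by simp
    then show "e \<in> set p \<longleftrightarrow> e \<in> set q" by (simp split: if_splits)
  qed
  then show "p = q" using apath_subset_imp_eq pq(1,2) by blast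
qed

text \<open>
  \<open>QS S\<close> is the face of \<open>Q\<close> over the face of all flows supported on \<open>S\<close>. If there are at least two
  paths, every path \<open>v\<close> has a facet \<open>F\<close> such that \<open>v\<close> is the only path with \<open>\<not> QS (set v) \<subseteq> F\<close>.
\<close>

lemma card_paths_le_card_facets:
  fixes Q :: "'b::real_vector set"
  assumes avoid: "\<And>v. v \<in> verts D - {s, t} \<Longrightarrow> \<exists>p. st_path p \<and> v \<notin> set (awalk_verts s p)"
    and Q: "simple_polytope Q" and ext: "extension_of Q (st_flow_polytope D s t)"
  shows "card {p. st_path p} \<le> card (facets Q)"
proof -
  have pQ: "polytope Q" using Q unfolding simple_polytope_def by blast
  obtain \<pi> where lin: "linear \<pi>" and img: "\<pi> ` Q = st_flow_polytope D s t"
    using ext unfolding extension_of_def by blast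
  have nn: "0 \<le> \<pi> x $ e" if "x \<in> Q" for x e
    using img that by (auto simp: st_flow_polytope_eq st_flow_def)
  define QS where "QS S = {x \<in> Q. \<forall>e. e \<notin> S \<longrightarrow> \<pi> x $ e = 0}" for S
  have comb: "\<pi> ((1 - k) *\<^sub>R a + k *\<^sub>R b) $ e = (1 - k) * \<pi> a $ e + k * \<pi> b $ e" for k a b e
    using lin by (simp add: linear_add linear_cmul)
  have face: "QS S face_of Q" for S
    unfolding face_of_def
  proof (intro conjI ballI impI)
    show "QS S \<subseteq> Q" unfolding QS_def by blast
    show "convex (QS S)"
      using polytope_imp_convex[OF pQ] unfolding convex_alt QS_def by (auto simp: comb)
    fix a b x assume ab: "a \<in> Q" "b \<in> Q" and x: "x \<in> QS S" "x \<in> open_segment a b"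
    from x(2) obtain k where k: "0 < k" "k < 1" "x = (1 - k) *\<^sub>R a + k *\<^sub>R b"
      by (auto simp: in_segment)
    have "\<pi> a $ e = 0 \<and> \<pi> b $ e = 0" if "e \<notin> S" for e
    proof -
      have "(1 - k) * \<pi> a $ e + k * \<pi> b $ e = 0"
        using x(1) that k(3) comb unfolding QS_def by auto
      moreover have "0 \<le> (1 - k) * \<pi> a $ e" "0 \<le> k * \<pi> b $ e" using nn ab k by auto
      ultimately have "(1 - k) * \<pi> a $ e = 0" "k * \<pi> b $ e = 0" by linarith+
      then show ?thesis using k by simp
    qed
    then show "a \<in> QS S" "b \<in> QS S" unfolding QS_def using ab by blast+
  qed
  have mono: "QS S \<subseteq> QS T" if "S \<subseteq> T" for S T unfolding QS_def using that by blast
  have Int: "QS S \<inter> QS T = QS (S \<inter> T)" for S T unfolding QS_def by blast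
  have ne: "QS S \<noteq> {}" if w: "st_path w" "set w \<subseteq> S" for w S
  proof -
    have "path_vector w \<in> \<pi> ` Q" using path_vector_in_flow_polytope[OF w(1)] img by simp
    then obtain x where "x \<in> Q" "\<pi> x = path_vector w" by auto
    then have "x \<in> QS S" unfolding QS_def using w(2) by auto
    then show ?thesis by blast
  qed
  \<comment> \<open>A flow with positive value on \<open>f\<close> has a path through \<open>f\<close> in its support.\<close>
  have unused: "QS S = QS (S - {f})" if f: "\<And>r. st_path r \<Longrightarrow> set r \<subseteq> S \<Longrightarrow> f \<notin> set r" for S f
  proof
    show "QS (S - {f}) \<subseteq> QS S" by (rule mono) blast
    show "QS S \<subseteq> QS (S - {f})"
    proof
      fix x assume x: "x \<in> QS S"
      then have P: "\<pi> x \<in> st_flow_polytope D s t" using img unfolding QS_def by blast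
      have "\<pi> x $ f = 0"
      proof (rule ccontr)
        assume "\<pi> x $ f \<noteq> 0"
        then obtain r where "st_path r" "f \<in> set r" "\<And>e. e \<in> set r \<Longrightarrow> \<pi> x $ e \<noteq> 0"
          using flow_support_path[OF P] by blast
        then show False using f[of r] x unfolding QS_def by blast
      qed
      then show "x \<in> QS (S - {f})" using x unfolding QS_def by auto
    qed
  qed
  \<comment> \<open>The support of a flow in both faces would contain a path, which has to be both \<open>u\<close> and \<open>v\<close>.\<close>
  have disj: "x \<notin> QS (set u)" if uv: "st_path u" "st_path v" "u \<noteq> v" "x \<in> QS (set v)" for u v x
  proof
    assume x: "x \<in> QS (set u)"
    then have "st_flow 1 (\<pi> x)" using img unfolding QS_def by (auto simp: st_flow_polytope_eq)
    then obtain p where p: "st_path p" and pos: "\<And>e. e \<in> set p \<Longrightarrow> \<pi> x $ e > 0"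
      using st_flow_support_path[of 1 "\<pi> x"] by auto
    have "set p \<subseteq> set w" if "x \<in> QS (set w)" for w
      using pos that unfolding QS_def by force
    then have "p = u" "p = v"
      using apath_subset_imp_eq[OF p] uv x by auto
    then show False using uv(3) by simp
  qed
  have private_facet: "\<exists>F\<in>facets Q. \<not> QS (set v) \<subseteq> F \<and> (\<forall>q. st_path q \<longrightarrow> \<not> QS (set q) \<subseteq> F \<longrightarrow> q = v)"
    if uv: "st_path u" "st_path v" "u \<noteq> v" for u v
  proof -
    obtain y where y: "y \<in> QS (set v)" using ne[OF uv(2) order.refl] by blast
    then have "y \<in> Q" "y \<notin> QS (set u)" using disj[OF uv] unfolding QS_def by blast+
    then obtain F where F: "F \<in> facets Q" "QS (set u) \<subseteq> F" "y \<notin> F"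
      using facet_separating[OF pQ face ne[OF uv(1) order.refl]] by blast
    have nv: "\<not> QS (set v) \<subseteq> F" using y F(3) by blast
    have "q = v" if q: "st_path q" "\<not> QS (set q) \<subseteq> F" for q
    proof (rule prime_ideal_misses_one_path[where J = "\<lambda>S. QS S \<subseteq> F", OF avoid _ _ _ uv(1) F(2) uv(2) nv q])
      show "QS S \<subseteq> F" if "S \<subseteq> T" "QS T \<subseteq> F" for S T using that mono by blast
      show "QS S \<subseteq> F \<or> QS T \<subseteq> F" if "st_path w" "set w \<subseteq> S \<inter> T" "QS (S \<inter> T) \<subseteq> F" for S T w
        using simple_polytope_facet_prime[OF Q F(1) face face, of S T] ne[OF that(1,2)] that(3)
        unfolding Int by blast
      show "QS S \<subseteq> F" if "\<And>r. st_path r \<Longrightarrow> set r \<subseteq> S \<Longrightarrow> f \<notin> set r" "QS (S - {f}) \<subseteq> F" for S f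
        using unused[of S f] that by blast
    qed
    then show ?thesis using F(1) nv by blast
  qed
  show ?thesis
  proof (cases "\<exists>u v. st_path u \<and> st_path v \<and> u \<noteq> v")
    case True
    define P where "P v F \<longleftrightarrow> F \<in> facets Q \<and> \<not> QS (set v) \<subseteq> F \<and> (\<forall>q. st_path q \<longrightarrow> \<not> QS (set q) \<subseteq> F \<longrightarrow> q = v)" for v F
    have "\<exists>F. P v F" if v: "st_path v" for v
    proof -
      obtain u where "st_path u" "u \<noteq> v" using True v by blast
      then show ?thesis using private_facet[of u v] v unfolding P_def by blast
    qed
    then obtain \<phi> where \<phi>: "\<And>v. st_path v \<Longrightarrow> P v (\<phi> v)" by metis
    have "inj_on \<phi> {p. st_path p}"
    proof (rule inj_onI)
      fix v w assume vw: "v \<in> {p. st_path p}" "w \<in> {p. st_path p}" "\<phi> v = \<phi> w"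
      then show "v = w" using \<phi>[of v] \<phi>[of w] unfolding P_def by auto
    qed
    moreover have "\<phi> ` {p. st_path p} \<subseteq> facets Q" using \<phi> unfolding P_def by blast
    ultimately show ?thesis using finite_facets[OF pQ] by (intro card_inj_on_le)
  next
    case False
    show ?thesis
    proof (cases "\<exists>v. st_path v")
      case True
      then obtain v where v: "st_path v" by blast
      then have "{p. st_path p} = {v}" using False by blast
      moreover have "Q \<noteq> {}" using ne[OF v order.refl] unfolding QS_def by blast
      then have "card (facets Q) > 0"
        using facets_nonempty[OF pQ] finite_facets[OF pQ] by (simp add: card_gt_0_iff)
      ultimately show ?thesis by simp
    next
      case False
      then have "{p. st_path p} = {}" by blast
      then show ?thesis by (metis card.empty le0)
    qed
  qed
qed

end

theorem theorem6p1:
  fixes D :: "('v, 'e::finite) pre_digraph" and s t :: 'v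
  assumes "fin_digraph D"
    and "\<not> (\<exists>c. pre_digraph.cycle D c)"
    and "s \<in> verts D" and "t \<in> verts D" and "s \<noteq> t"
    and "\<And>v. v \<in> verts D - {s, t} \<Longrightarrow>
           \<exists>p. pre_digraph.apath D s p t \<and> v \<notin> set (pre_digraph.awalk_verts D s p)"
  shows "sxc (st_flow_polytope D s t) = card {p. pre_digraph.apath D s p t}"
proof -
  interpret st_dag D s t
    using assms(1-5) by (intro st_dag.intro st_dag_axioms.intro)
  let ?X = "path_vector ` {p. st_path p} :: (real ^ 'e) set"
  have "finite ?X" using apaths_finite by blast
  then obtain Q :: "(nat \<Rightarrow>\<^sub>0 real) set" where Q: "simple_polytope Q"
    "extension_of Q (convex hull ?X)" "card (facets Q) = card ?X"
    by (rule convex_hull_finite_simplex_extension)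
  moreover have "card ?X = card {p. st_path p}" using path_vector_inj by (rule card_image)
  ultimately show ?thesis
    unfolding sxc_def st_flow_polytope_eq_convex_hull[symmetric]
    by (intro Least_equality) (use card_paths_le_card_facets[OF assms(6)] in \<open>force+\<close>)
qed

end
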